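(* Let $\mathbb G$ be a category and let $(\mathscr C,\mathtt{A})$ be a surcomplete and surcocomplete surcategory over $\mathbb G$ with $K$-equalizers. Let $T$ be a surmonad on $(\mathscr C,\mathtt{A})$ which preserves $\kappa$-filtered surcolimits for some regular cardinal $\kappa$. Then the surcategory $(\mathscr C^T,\mathtt{A})$ of suralgebras is surcomplete, surcocomplete, and has $K$-equalizers.
   Context: A surcategory over $\mathbb G$ is a pair $(\mathscr E,\mathtt{A})$ with $\mathtt{A}:\mathscr E\to\mathbb G$ a functor (the arity functor), i.e. an object of the 2-category $\mathrm{Cat}/\mathbb G$. A surmonad on $(\mathscr E,\mathtt{A})$ is a monad in $\mathrm{Cat}/\mathbb G$, i.e. a monad $T$ on $\mathscr E$ with $\mathtt{A}T=\mathtt{A}$ and whose unit and multiplication have components sent by $\mathtt{A}$ to identities. The Eilenberg–Moore category $\mathscr E^T$ (whose objects are called suralgebras) is a surcategory over $\mathbb G$ with arity functor $(x,h)\mapsto\mathtt{A}(x)$. Surlimits: let $J$ be a small category, $D:J\to\mathscr E$ a functor and $B$ an object of $\mathbb G$ such that $\mathtt{A}D$ is the constant functor $\Delta(B)$. A surlimit of $(D,B)$ is an object $x$ with $\mathtt{A}(x)=B$ and a cone $\tau:\Delta(x)\to D$ whose components are sent by $\mathtt{A}$ to $1_B$, such that for every object $y$, every arrow $b:\mathtt{A}(y)\to B$ in $\mathbb G$ and every cone $\sigma:\Delta(y)\to D$ all of whose components are sent by $\mathtt{A}$ to $b$, there is a unique $f:y\to x$ in $\mathscr E$ with $\mathtt{A}(f)=b$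 and $\tau\Delta(f)=\sigma$. Surcolimits are defined dually (a cocone $D\to\Delta(x)$ over $1_B$, universal among cocones $D\to\Delta(y)$ over arbitrary arrows $b:B\to\mathtt{A}(y)$). $(\mathscr E,\mathtt{A})$ is surcomplete (resp. surcocomplete) if for every small $J$ (including the empty one) every such $(D,B)$ has a surlimit (resp. surcolimit). A $\kappa$-filtered surcolimit is a surcolimit indexed by a small $\kappa$-filtered category. $(\mathscr E,\mathtt{A})$ has $K$-equalizers if every pair $f,g:a\rightrightarrows b$ in $\mathscr E$ with $\mathtt{A}(f)=\mathtt{A}(g)$ has an equalizer $e$ in $\mathscr E$ with $\mathtt{A}(e)=1_{\mathtt{A}(a)}$. *)

theory Defs
  imports Main
begin

unbundle cardinal_syntax

section \<open>Categories, functors, natural transformations\<close>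

record ('o, 'm) cat =
  Obj :: "'o set"
  Arr :: "'m set"
  Dom :: "'m \<Rightarrow> 'o"
  Cod :: "'m \<Rightarrow> 'o"
  Ide :: "'o \<Rightarrow> 'm"
  Cmp :: "'m \<Rightarrow> 'm \<Rightarrow> 'm"  (infixl \<open>\<cdot>\<index>\<close> 70)

text \<open>Composition is in applicative order: \<open>g \<cdot>\<^bsub>C\<^esub> f\<close> is \<open>f\<close> followed by \<open>g\<close>. The values of
  the operations outside \<open>Obj C\<close>, \<open>Arr C\<close> and composable pairs are irrelevant.\<close>

definition Hom :: "('o, 'm) cat \<Rightarrow> 'o \<Rightarrow> 'o \<Rightarrow> 'm set" where
  "Hom C x y = {f \<in> Arr C. Dom C f = x \<and> Cod C f = y}"

locale category =
  fixes C :: "('o, 'm) cat" (structure)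
  assumes Dom_Obj: "f \<in> Arr C \<Longrightarrow> Dom C f \<in> Obj C"
    and Cod_Obj: "f \<in> Arr C \<Longrightarrow> Cod C f \<in> Obj C"
    and Ide_Hom: "x \<in> Obj C \<Longrightarrow> Ide C x \<in> Hom C x x"
    and Cmp_Hom: "\<lbrakk>f \<in> Hom C x y; g \<in> Hom C y z\<rbrakk> \<Longrightarrow> g \<cdot> f \<in> Hom C x z"
    and Cmp_Ide_left: "f \<in> Hom C x y \<Longrightarrow> Ide C y \<cdot> f = f"
    and Cmp_Ide_right: "f \<in> Hom C x y \<Longrightarrow> f \<cdot> Ide C x = f"
    and Cmp_assoc: "\<lbrakk>f \<in> Hom C w x; g \<in> Hom C x y; h \<in> Hom C y z\<rbrakk>
      \<Longrightarrow> h \<cdot> (g \<cdot> f) = (h \<cdot> g) \<cdot> f"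

record ('o, 'm, 'p, 'n) func =
  FObj :: "'o \<Rightarrow> 'p"
  FArr :: "'m \<Rightarrow> 'n"

definition is_functor ::
    "('o, 'm) cat \<Rightarrow> ('p, 'n) cat \<Rightarrow> ('o, 'm, 'p, 'n) func \<Rightarrow> bool" where
  "is_functor C D F \<longleftrightarrow>
     (\<forall>x\<in>Obj C. FObj F x \<in> Obj D) \<and>
     (\<forall>x\<in>Obj C. \<forall>y\<in>Obj C. \<forall>f\<in>Hom C x y. FArr F f \<in> Hom D (FObj F x) (FObj F y)) \<and>
     (\<forall>x\<in>Obj C. FArr F (Ide C x) = Ide D (FObj F x)) \<and>
     (\<forall>x\<in>Obj C. \<forall>y\<in>Obj C. \<forall>z\<in>Obj C. \<forall>f\<in>Hom C x y. \<forall>g\<in>Hom C y z.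
        FArr F (g \<cdot>\<^bsub>C\<^esub> f) = FArr F g \<cdot>\<^bsub>D\<^esub> FArr F f)"

text \<open>Equality of functors with domain \<open>C\<close>; the underlying HOL functions may differ off \<open>C\<close>.\<close>

definition func_eq ::
    "('o, 'm) cat \<Rightarrow> ('o, 'm, 'p, 'n) func \<Rightarrow> ('o, 'm, 'p, 'n) func \<Rightarrow> bool" where
  "func_eq C F F' \<longleftrightarrow>
     (\<forall>x\<in>Obj C. FObj F x = FObj F' x) \<and> (\<forall>f\<in>Arr C. FArr F f = FArr F' f)"

definition id_func :: "('o, 'm, 'o, 'm) func" where
  "id_func = \<lparr>FObj = (\<lambda>x. x), FArr = (\<lambda>f. f)\<rparr>"

definition comp_func ::
    "('p, 'n, 'q, 'l) func \<Rightarrow> ('o, 'm, 'p, 'n) func \<Rightarrow> ('o, 'm, 'q, 'l) func"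
    (infixr \<open>\<circ>\<^sub>F\<close> 55) where
  "F' \<circ>\<^sub>F F = \<lparr>FObj = FObj F' \<circ> FObj F, FArr = FArr F' \<circ> FArr F\<rparr>"

definition const_func :: "('p, 'n) cat \<Rightarrow> 'p \<Rightarrow> ('o, 'm, 'p, 'n) func" where
  "const_func D x = \<lparr>FObj = (\<lambda>_. x), FArr = (\<lambda>_. Ide D x)\<rparr>"

definition nat_trans ::
    "('o, 'm) cat \<Rightarrow> ('p, 'n) cat \<Rightarrow> ('o, 'm, 'p, 'n) func \<Rightarrow> ('o, 'm, 'p, 'n) func
      \<Rightarrow> ('o \<Rightarrow> 'n) \<Rightarrow> bool" where
  "nat_trans C D F F' \<alpha> \<longleftrightarrow>
     (\<forall>x\<in>Obj C. \<alpha> x \<in> Hom D (FObj F x) (FObj F' x)) \<and>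
     (\<forall>x\<in>Obj C. \<forall>y\<in>Obj C. \<forall>f\<in>Hom C x y.
        FArr F' f \<cdot>\<^bsub>D\<^esub> \<alpha> x = \<alpha> y \<cdot>\<^bsub>D\<^esub> FArr F f)"

definition is_cone ::
    "('o, 'm) cat \<Rightarrow> ('p, 'n) cat \<Rightarrow> ('o, 'm, 'p, 'n) func \<Rightarrow> 'p \<Rightarrow> ('o \<Rightarrow> 'n) \<Rightarrow> bool" where
  "is_cone J E D x \<tau> \<longleftrightarrow> x \<in> Obj E \<and> nat_trans J E (const_func E x) D \<tau>"

definition is_cocone ::
    "('o, 'm) cat \<Rightarrow> ('p, 'n) cat \<Rightarrow> ('o, 'm, 'p, 'n) func \<Rightarrow> 'p \<Rightarrow> ('o \<Rightarrow> 'n) \<Rightarrow> bool" where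
  "is_cocone J E D x \<tau> \<longleftrightarrow> x \<in> Obj E \<and> nat_trans J E D (const_func E x) \<tau>"


section \<open>Smallness and filteredness\<close>

text \<open>Smallness is relative to a type \<open>'u\<close>: a set is small if its cardinality is strictly below that
  of \<open>UNIV :: 'u set\<close>. If the latter is an inaccessible cardinal this is smallness with respect to a
  Grothendieck universe; nothing is assumed about \<open>'u\<close>, so that case is included. Up to
  isomorphism, every small category has its objects and arrows in \<open>'u\<close>. Because of the identities
  it suffices to bound the set of arrows.\<close>

definition small_category :: "('u, 'u) cat \<Rightarrow> bool" where
  "small_category J \<longleftrightarrow> category J \<and> |Arr J| <o |UNIV :: 'u set|"

definition small_regular_cardinal :: "'u rel \<Rightarrow> bool" where
  "small_regular_cardinal \<kappa> \<longleftrightarrow> Cinfinite \<kappa> \<and> regularCard \<kappa> \<and> \<kappa> <o |UNIV :: 'u set|"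

text \<open>\<open>J\<close> is \<open>\<kappa>\<close>-filtered if every diagram in \<open>J\<close> with fewer than \<open>\<kappa>\<close> arrows has a cocone.\<close>

definition filtered_category :: "'u rel \<Rightarrow> ('u, 'u) cat \<Rightarrow> bool" where
  "filtered_category \<kappa> J \<longleftrightarrow> category J \<and>
     (\<forall>(K :: ('u, 'u) cat) F. category K \<and> |Arr K| <o \<kappa> \<and> is_functor K J F
        \<longrightarrow> (\<exists>x \<sigma>. is_cocone K J F x \<sigma>))"


section \<open>Surcategories, surlimits and surcolimits\<close>

locale surcategory = E: category E + G: category G
  for E :: "('o, 'm) cat" and G :: "('p, 'n) cat" +
  fixes A :: "('o, 'm, 'p, 'n) func"
  assumes arity_functor: "is_functor E G A"

definition surdiagram ::
    "('o, 'm) cat \<Rightarrow> ('p, 'n) cat \<Rightarrow> ('o, 'm, 'p, 'n) func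
      \<Rightarrow> ('i, 'j) cat \<Rightarrow> ('i, 'j, 'o, 'm) func \<Rightarrow> 'p \<Rightarrow> bool" where
  "surdiagram E G A J D B \<longleftrightarrow>
     is_functor J E D \<and> B \<in> Obj G \<and> func_eq J (A \<circ>\<^sub>F D) (const_func G B)"

definition is_surlimit ::
    "('o, 'm) cat \<Rightarrow> ('p, 'n) cat \<Rightarrow> ('o, 'm, 'p, 'n) func
      \<Rightarrow> ('i, 'j) cat \<Rightarrow> ('i, 'j, 'o, 'm) func \<Rightarrow> 'p \<Rightarrow> 'o \<Rightarrow> ('i \<Rightarrow> 'm) \<Rightarrow> bool" where
  "is_surlimit E G A J D B x \<tau> \<longleftrightarrow>
     is_cone J E D x \<tau> \<and> FObj A x = B \<and> (\<forall>j\<in>Obj J. FArr A (\<tau> j) = Ide G B) \<and>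
     (\<forall>y\<in>Obj E. \<forall>b\<in>Hom G (FObj A y) B. \<forall>\<sigma>.
        is_cone J E D y \<sigma> \<and> (\<forall>j\<in>Obj J. FArr A (\<sigma> j) = b) \<longrightarrow>
        (\<exists>!f. f \<in> Hom E y x \<and> FArr A f = b \<and> (\<forall>j\<in>Obj J. \<tau> j \<cdot>\<^bsub>E\<^esub> f = \<sigma> j)))"

definition is_surcolimit ::
    "('o, 'm) cat \<Rightarrow> ('p, 'n) cat \<Rightarrow> ('o, 'm, 'p, 'n) func
      \<Rightarrow> ('i, 'j) cat \<Rightarrow> ('i, 'j, 'o, 'm) func \<Rightarrow> 'p \<Rightarrow> 'o \<Rightarrow> ('i \<Rightarrow> 'm) \<Rightarrow> bool" where
  "is_surcolimit E G A J D B x \<tau> \<longleftrightarrow>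
     is_cocone J E D x \<tau> \<and> FObj A x = B \<and> (\<forall>j\<in>Obj J. FArr A (\<tau> j) = Ide G B) \<and>
     (\<forall>y\<in>Obj E. \<forall>b\<in>Hom G B (FObj A y). \<forall>\<sigma>.
        is_cocone J E D y \<sigma> \<and> (\<forall>j\<in>Obj J. FArr A (\<sigma> j) = b) \<longrightarrow>
        (\<exists>!f. f \<in> Hom E x y \<and> FArr A f = b \<and> (\<forall>j\<in>Obj J. f \<cdot>\<^bsub>E\<^esub> \<tau> j = \<sigma> j)))"

definition surcomplete ::
    "'u itself \<Rightarrow> ('o, 'm) cat \<Rightarrow> ('p, 'n) cat \<Rightarrow> ('o, 'm, 'p, 'n) func \<Rightarrow> bool" where
  "surcomplete U E G A \<longleftrightarrow>
     (\<forall>(J :: ('u, 'u) cat) D B. small_category J \<and> surdiagram E G A J D B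
        \<longrightarrow> (\<exists>x \<tau>. is_surlimit E G A J D B x \<tau>))"

definition surcocomplete ::
    "'u itself \<Rightarrow> ('o, 'm) cat \<Rightarrow> ('p, 'n) cat \<Rightarrow> ('o, 'm, 'p, 'n) func \<Rightarrow> bool" where
  "surcocomplete U E G A \<longleftrightarrow>
     (\<forall>(J :: ('u, 'u) cat) D B. small_category J \<and> surdiagram E G A J D B
        \<longrightarrow> (\<exists>x \<tau>. is_surcolimit E G A J D B x \<tau>))"

definition is_equalizer :: "('o, 'm) cat \<Rightarrow> 'o \<Rightarrow> 'o \<Rightarrow> 'm \<Rightarrow> 'm \<Rightarrow> 'o \<Rightarrow> 'm \<Rightarrow> bool" where
  "is_equalizer E a b f g k e \<longleftrightarrow>
     k \<in> Obj E \<and> e \<in> Hom E k a \<and> f \<cdot>\<^bsub>E\<^esub> e = g \<cdot>\<^bsub>E\<^esub> e \<and>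
     (\<forall>y\<in>Obj E. \<forall>h\<in>Hom E y a. f \<cdot>\<^bsub>E\<^esub> h = g \<cdot>\<^bsub>E\<^esub> h \<longrightarrow>
        (\<exists>!u. u \<in> Hom E y k \<and> e \<cdot>\<^bsub>E\<^esub> u = h))"

definition has_K_equalizers ::
    "('o, 'm) cat \<Rightarrow> ('p, 'n) cat \<Rightarrow> ('o, 'm, 'p, 'n) func \<Rightarrow> bool" where
  "has_K_equalizers E G A \<longleftrightarrow>
     (\<forall>a\<in>Obj E. \<forall>b\<in>Obj E. \<forall>f\<in>Hom E a b. \<forall>g\<in>Hom E a b. FArr A f = FArr A g \<longrightarrow>
        (\<exists>k e. is_equalizer E a b f g k e \<and> FArr A e = Ide G (FObj A a)))"


section \<open>Surmonads and suralgebras\<close>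

locale surmonad = surcategory E G A
  for E :: "('o, 'm) cat" (structure) and G :: "('p, 'n) cat" and A :: "('o, 'm, 'p, 'n) func" +
  fixes T :: "('o, 'm, 'o, 'm) func" and \<eta> \<mu> :: "'o \<Rightarrow> 'm"
  assumes T_functor: "is_functor E E T"
    and unit_nat: "nat_trans E E id_func T \<eta>"
    and mult_nat: "nat_trans E E (T \<circ>\<^sub>F T) T \<mu>"
    and unit_left: "x \<in> Obj E \<Longrightarrow> \<mu> x \<cdot> \<eta> (FObj T x) = Ide E (FObj T x)"
    and unit_right: "x \<in> Obj E \<Longrightarrow> \<mu> x \<cdot> FArr T (\<eta> x) = Ide E (FObj T x)"
    and mult_assoc: "x \<in> Obj E \<Longrightarrow> \<mu> x \<cdot> \<mu> (FObj T x) = \<mu> x \<cdot> FArr T (\<mu> x)"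
    and arity_T: "func_eq E (A \<circ>\<^sub>F T) A"
    and arity_unit: "x \<in> Obj E \<Longrightarrow> FArr A (\<eta> x) = Ide G (FObj A x)"
    and arity_mult: "x \<in> Obj E \<Longrightarrow> FArr A (\<mu> x) = Ide G (FObj A x)"

definition preserves_filtered_surcolimits ::
    "'u rel \<Rightarrow> ('o, 'm) cat \<Rightarrow> ('p, 'n) cat \<Rightarrow> ('o, 'm, 'p, 'n) func
      \<Rightarrow> ('o, 'm, 'o, 'm) func \<Rightarrow> bool" where
  "preserves_filtered_surcolimits \<kappa> E G A T \<longleftrightarrow>
     (\<forall>(J :: ('u, 'u) cat) D B x \<tau>.
        small_category J \<and> filtered_category \<kappa> J \<and> surdiagram E G A J D B \<and>
        is_surcolimit E G A J D B x \<tau>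
        \<longrightarrow> is_surcolimit E G A J (T \<circ>\<^sub>F D) B (FObj T x) (\<lambda>j. FArr T (\<tau> j)))"

definition is_algebra ::
    "('o, 'm) cat \<Rightarrow> ('o, 'm, 'o, 'm) func \<Rightarrow> ('o \<Rightarrow> 'm) \<Rightarrow> ('o \<Rightarrow> 'm) \<Rightarrow> 'o \<times> 'm \<Rightarrow> bool" where
  "is_algebra E T \<eta> \<mu> = (\<lambda>(x, h).
     x \<in> Obj E \<and> h \<in> Hom E (FObj T x) x \<and>
     h \<cdot>\<^bsub>E\<^esub> \<eta> x = Ide E x \<and> h \<cdot>\<^bsub>E\<^esub> \<mu> x = h \<cdot>\<^bsub>E\<^esub> FArr T h)"

text \<open>The Eilenberg--Moore category. An arrow \<open>f : (x, h) \<rightarrow> (y, k)\<close> is the triple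
  \<open>((x, h), f, (y, k))\<close>, because \<open>f\<close> alone does not determine the structure maps.\<close>

definition EM ::
    "('o, 'm) cat \<Rightarrow> ('o, 'm, 'o, 'm) func \<Rightarrow> ('o \<Rightarrow> 'm) \<Rightarrow> ('o \<Rightarrow> 'm)
      \<Rightarrow> ('o \<times> 'm, ('o \<times> 'm) \<times> 'm \<times> ('o \<times> 'm)) cat" where
  "EM E T \<eta> \<mu> =
    \<lparr>Obj = {a. is_algebra E T \<eta> \<mu> a},
     Arr = {(a, f, b). is_algebra E T \<eta> \<mu> a \<and> is_algebra E T \<eta> \<mu> b \<and>
              f \<in> Hom E (fst a) (fst b) \<and> f \<cdot>\<^bsub>E\<^esub> snd a = snd b \<cdot>\<^bsub>E\<^esub> FArr T f},
     Dom = (\<lambda>(a, f, b). a),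
     Cod = (\<lambda>(a, f, b). b),
     Ide = (\<lambda>a. (a, Ide E (fst a), a)),
     Cmp = (\<lambda>(b, g, c) (a, f, b'). (a, g \<cdot>\<^bsub>E\<^esub> f, c))\<rparr>"

definition EM_arity ::
    "('o, 'm, 'p, 'n) func \<Rightarrow> ('o \<times> 'm, ('o \<times> 'm) \<times> 'm \<times> ('o \<times> 'm), 'p, 'n) func" where
  "EM_arity A = \<lparr>FObj = (\<lambda>(x, h). FObj A x), FArr = (\<lambda>(a, f, b). FArr A f)\<rparr>"

lemma (in surmonad) surcategory_EM: "surcategory (EM E T \<eta> \<mu>) G (EM_arity A)"
proof -
  let ?M = "EM E T \<eta> \<mu>"
  have TH: "FArr T f \<in> Hom E (FObj T x) (FObj T y)" if "f \<in> Hom E x y" for f x y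
    using T_functor that E.Dom_Obj E.Cod_Obj unfolding is_functor_def Hom_def by blast
  have TI: "FArr T (Ide E x) = Ide E (FObj T x)" if "x \<in> Obj E" for x
    using T_functor that unfolding is_functor_def by blast
  have ends: "x \<in> Obj E" "y \<in> Obj E" if "f \<in> Hom E x y" for f x y
    using that E.Dom_Obj E.Cod_Obj unfolding Hom_def by auto
  have TC: "FArr T (g \<cdot> f) = FArr T g \<cdot> FArr T f"
    if "f \<in> Hom E x y" "g \<in> Hom E y z" for f g x y z
    using T_functor that ends[OF that(1)] ends[OF that(2)] unfolding is_functor_def by blast
  have AH: "FArr A f \<in> Hom G (FObj A x) (FObj A y)" if "f \<in> Hom E x y" for f x y
    using arity_functor that ends[OF that] unfolding is_functor_def by blast
  have AI: "FArr A (Ide E x) = Ide G (FObj A x)" if "x \<in> Obj E" for x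
    using arity_functor that unfolding is_functor_def by blast
  have AC: "FArr A (g \<cdot> f) = FArr A g \<cdot>\<^bsub>G\<^esub> FArr A f"
    if "f \<in> Hom E x y" "g \<in> Hom E y z" for f g x y z
    using arity_functor that ends[OF that(1)] ends[OF that(2)] unfolding is_functor_def by blast
  have alg: "fst a \<in> Obj E" "snd a \<in> Hom E (FObj T (fst a)) (fst a)"
    if "is_algebra E T \<eta> \<mu> a" for a
    using that unfolding is_algebra_def by (auto split: prod.splits)
  have hom: "f \<in> Hom ?M a b \<longleftrightarrow> is_algebra E T \<eta> \<mu> a \<and> is_algebra E T \<eta> \<mu> b \<and>
      (\<exists>f'. f = (a, f', b) \<and> f' \<in> Hom E (fst a) (fst b) \<and> f' \<cdot> snd a = snd b \<cdot> FArr T f')"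
    for f a b
    unfolding Hom_def EM_def by (cases f) auto
  have cmp: "(b, g, c) \<cdot>\<^bsub>?M\<^esub> (a, f, b') = (a, g \<cdot> f, c)" for a b b' c f g
    by (simp add: EM_def)
  have ide: "Ide ?M a = (a, Ide E (fst a), a)" for a
    by (simp add: EM_def)
  have obj: "a \<in> Obj ?M \<longleftrightarrow> is_algebra E T \<eta> \<mu> a" for a
    by (simp add: EM_def)
  have cat: "category ?M"
  proof
    fix f assume "f \<in> Arr ?M"
    then show "Dom ?M f \<in> Obj ?M" "Cod ?M f \<in> Obj ?M"
      by (auto simp: EM_def)
  next
    fix a assume "a \<in> Obj ?M"
    then have a: "is_algebra E T \<eta> \<mu> a" by (simp add: obj)
    have "Ide E (fst a) \<cdot> snd a = snd a \<cdot> FArr T (Ide E (fst a))"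
      by (simp add: TI[OF alg(1)[OF a]] E.Cmp_Ide_left[OF alg(2)[OF a]]
          E.Cmp_Ide_right[OF alg(2)[OF a]])
    then show "Ide ?M a \<in> Hom ?M a a"
      using a E.Ide_Hom[OF alg(1)[OF a]] by (simp add: hom ide)
  next
    fix f a b g c assume "f \<in> Hom ?M a b" "g \<in> Hom ?M b c"
    then obtain f' g' where f: "f = (a, f', b)" "f' \<in> Hom E (fst a) (fst b)"
        "f' \<cdot> snd a = snd b \<cdot> FArr T f'"
      and g: "g = (b, g', c)" "g' \<in> Hom E (fst b) (fst c)" "g' \<cdot> snd b = snd c \<cdot> FArr T g'"
      and al: "is_algebra E T \<eta> \<mu> a" "is_algebra E T \<eta> \<mu> b" "is_algebra E T \<eta> \<mu> c"
      unfolding hom by blast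
    have "(g' \<cdot> f') \<cdot> snd a = g' \<cdot> (snd b \<cdot> FArr T f')"
      using E.Cmp_assoc[OF alg(2)[OF al(1)] f(2) g(2)] f(3) by simp
    also have "\<dots> = (snd c \<cdot> FArr T g') \<cdot> FArr T f'"
      using E.Cmp_assoc[OF TH[OF f(2)] alg(2)[OF al(2)] g(2)] g(3) by simp
    also have "\<dots> = snd c \<cdot> FArr T (g' \<cdot> f')"
      using E.Cmp_assoc[OF TH[OF f(2)] TH[OF g(2)] alg(2)[OF al(3)]] TC[OF f(2) g(2)] by simp
    finally show "g \<cdot>\<^bsub>?M\<^esub> f \<in> Hom ?M a c"
      using al E.Cmp_Hom[OF f(2) g(2)] by (simp add: hom f(1) g(1) cmp)
  next
    fix f a b assume "f \<in> Hom ?M a b"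
    then show "Ide ?M b \<cdot>\<^bsub>?M\<^esub> f = f" "f \<cdot>\<^bsub>?M\<^esub> Ide ?M a = f"
      using E.Cmp_Ide_left E.Cmp_Ide_right by (auto simp: hom ide cmp)
  next
    fix f a b g c h d assume "f \<in> Hom ?M a b" "g \<in> Hom ?M b c" "h \<in> Hom ?M c d"
    then show "h \<cdot>\<^bsub>?M\<^esub> (g \<cdot>\<^bsub>?M\<^esub> f) = (h \<cdot>\<^bsub>?M\<^esub> g) \<cdot>\<^bsub>?M\<^esub> f"
      using E.Cmp_assoc by (auto simp: hom cmp)
  qed
  have O: "FObj (EM_arity A) a = FObj A (fst a)" for a
    by (simp add: EM_arity_def case_prod_unfold)
  have R: "FArr (EM_arity A) (a, f, b) = FArr A f" for a f b
    by (simp add: EM_arity_def)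
  have "is_functor ?M G (EM_arity A)"
    unfolding is_functor_def
  proof (intro conjI ballI)
    fix a assume "a \<in> Obj ?M"
    then have a: "fst a \<in> Obj E" using alg obj by simp
    show "FObj (EM_arity A) a \<in> Obj G"
      using arity_functor a unfolding is_functor_def O by blast
    show "FArr (EM_arity A) (Ide ?M a) = Ide G (FObj (EM_arity A) a)"
      by (simp add: O R ide AI[OF a])
  next
    fix a b f assume "f \<in> Hom ?M a b"
    then show "FArr (EM_arity A) f \<in> Hom G (FObj (EM_arity A) a) (FObj (EM_arity A) b)"
      using AH by (auto simp: hom O R)
  next
    fix a b c f g assume "f \<in> Hom ?M a b" "g \<in> Hom ?M b c"
    then show "FArr (EM_arity A) (g \<cdot>\<^bsub>?M\<^esub> f) = FArr (EM_arity A) g \<cdot>\<^bsub>G\<^esub> FArr (EM_arity A) f"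
      using AC by (auto simp: hom R cmp)
  qed
  then show ?thesis
    using cat G.category_axioms by (simp add: surcategory_def surcategory_axioms_def)
qed

end

theory Submission
  imports Defs
begin

text \<open>
  Limits and \<open>K\<close>-equalizers of suralgebras are computed on underlying objects. If \<open>x\<close> is the
  surlimit of the underlying objects of a diagram of algebras \<open>(X\<^sub>j, h\<^sub>j)\<close>, the maps
  \<open>h\<^sub>j \<cdot> T \<tau>\<^sub>j\<close> form a cone with vertex \<open>T x\<close>, which lies over the identity because the unit law
  puts every structure map over an identity (\<open>algebra_arity\<close>). The induced map \<open>T x \<rightarrow> x\<close> satisfies
  the algebra laws because they hold after composition with the legs (\<open>surlimit_creation\<close>); the
  same argument with a single leg gives \<open>K_equalizer_creation\<close>.

  Surcolimits need a transfinite construction, a variant of Kelly's free-algebra sequence. Given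
  algebras \<open>(X\<^sub>j, h\<^sub>j)\<close> over \<open>B\<close>, an algebra receiving a cocone from them is approximated by a chain
  of objects \<open>x\<^sub>\<alpha>\<close> over \<open>B\<close>, indexed by the elements of the cardinal \<open>\<kappa>\<close>. The object \<open>x\<^sub>\<alpha>\<close> is
  universal among objects receiving a cocone \<open>c\<^sub>j : X\<^sub>j \<rightarrow> x\<^sub>\<alpha>\<close> and, for every \<open>\<beta> < \<alpha>\<close>, a map
  \<open>a\<^sub>\<beta> : T x\<^sub>\<beta> \<rightarrow> x\<^sub>\<alpha>\<close>, the action restricted to what is already built, subject to
    \<^item> \<open>a\<^sub>\<beta> \<cdot> T c\<^sub>j = c\<^sub>j \<cdot> h\<^sub>j\<close>, so that the \<open>c\<^sub>j\<close> become homomorphisms, and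
    \<^item> \<open>a\<^sub>\<beta> \<cdot> T a\<^sub>\<gamma> = a\<^sub>\<gamma> \<cdot> \<mu>\<close> for \<open>\<gamma> < \<beta>\<close>, associativity as far as it makes sense.

  Zero, successor and limit stages are thus treated alike, and the links of the chain come for free:
  \<open>x\<^sub>\<beta> \<rightarrow> T x\<^sub>\<beta> \<rightarrow> x\<^sub>\<alpha>\<close>, the unit followed by the action. Their functoriality and their compatibility
  with the actions follow from the two equations and the monad laws (\<open>link_a\<close>, \<open>link_link\<close>,
  \<open>a_T_link\<close>). The stage \<open>x\<^sub>\<alpha>\<close> exists because generators and relations over \<open>B\<close> indexed by small
  sets present an object (\<open>generators_and_relations\<close>), being the surcolimit of a diagram of spans.

  Regularity makes \<open>\<kappa>\<close> a \<open>\<kappa>\<close>-filtered category (\<open>filtered_order_cat\<close>), so \<open>T\<close> and \<open>T T\<close> preserve the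
  surcolimit \<open>z\<close> of the chain. Since \<open>\<kappa>\<close> has no last element, the partial actions
  \<open>T x\<^sub>\<beta> \<rightarrow> x\<^sub>\<alpha> \<rightarrow> z\<close> glue to a total one \<open>T z \<rightarrow> z\<close>, and the two equations turn into the algebra laws
  (\<open>colimit_algebra\<close>). A cocone of homomorphisms into an algebra \<open>y\<close> over an arbitrary arrow
  \<open>b : B \<rightarrow> A y\<close> makes \<open>y\<close> itself a target of the universal property of every stage, so it extends
  uniquely along the chain by well-founded recursion (\<open>extension_exists\<close>, \<open>extension_unique\<close>). Because
  all stages are surcolimits, and not merely colimits in the fibre over \<open>B\<close>, this works over every
  \<open>b\<close> at once.
\<close>

section \<open>Calculating in categories\<close>

text \<open>Hom-sets are dissolved into the predicates \<open>Arr\<close>, \<open>Dom\<close> and \<open>Cod\<close>, so that the simplifier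
  can discharge the typing conditions of associativity and of the functor laws on its own; composites
  are normalised to the right.\<close>

lemma mem_Hom [simp]: "f \<in> Hom C x y \<longleftrightarrow> f \<in> Arr C \<and> Dom C f = x \<and> Cod C f = y"
  by (simp add: Hom_def)

context category
begin

lemma Ide_typing [simp]:
  assumes "x \<in> Obj C"
  shows "Ide C x \<in> Arr C" "Dom C (Ide C x) = x" "Cod C (Ide C x) = x"
  using Ide_Hom[OF assms] by simp_all

lemma Cmp_typing [simp]:
  assumes "f \<in> Arr C" "g \<in> Arr C" "Dom C g = Cod C f"
  shows "g \<cdot> f \<in> Arr C" "Dom C (g \<cdot> f) = Dom C f" "Cod C (g \<cdot> f) = Cod C g"
  using Cmp_Hom[of f "Dom C f" "Cod C f" g "Cod C g"] assms by simp_all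

lemma Cmp_Ide [simp]:
  assumes "f \<in> Arr C"
  shows "Cod C f = y \<Longrightarrow> Ide C y \<cdot> f = f" "Dom C f = x \<Longrightarrow> f \<cdot> Ide C x = f"
  using Cmp_Ide_left[of f "Dom C f" y] Cmp_Ide_right[of f x "Cod C f"] assms by simp_all

lemma Cmp_reassoc [simp]:
  assumes "f \<in> Arr C" "g \<in> Arr C" "h \<in> Arr C" "Dom C g = Cod C f" "Dom C h = Cod C g"
  shows "(h \<cdot> g) \<cdot> f = h \<cdot> (g \<cdot> f)"
  using Cmp_assoc[of f "Dom C f" "Cod C f" g "Cod C g" h "Cod C h"] assms by simp

declare Dom_Obj [simp] Cod_Obj [simp]

lemma ball_Hom:
  "(\<forall>x\<in>Obj C. \<forall>y\<in>Obj C. \<forall>f\<in>Hom C x y. P x y f) \<longleftrightarrow> (\<forall>f\<in>Arr C. P (Dom C f) (Cod C f) f)"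
  unfolding Hom_def using Dom_Obj Cod_Obj by blast

lemma ball_composable:
  "(\<forall>x\<in>Obj C. \<forall>y\<in>Obj C. \<forall>z\<in>Obj C. \<forall>f\<in>Hom C x y. \<forall>g\<in>Hom C y z. P f g) \<longleftrightarrow>
   (\<forall>f\<in>Arr C. \<forall>g\<in>Arr C. Dom C g = Cod C f \<longrightarrow> P f g)"
proof (intro iffI ballI impI)
  fix f g
  assume *: "\<forall>x\<in>Obj C. \<forall>y\<in>Obj C. \<forall>z\<in>Obj C. \<forall>f\<in>Hom C x y. \<forall>g\<in>Hom C y z. P f g"
    and "f \<in> Arr C" "g \<in> Arr C" "Dom C g = Cod C f"
  then show "P f g"
    using *[rule_format, of "Dom C f" "Cod C f" "Cod C g" f g] by simp
qed auto

end

lemma (in category) card_Obj_ordLeq_card_Arr: "|Obj C| \<le>o |Arr C|"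
proof (rule surj_imp_ordLeq, rule subsetI)
  fix x assume "x \<in> Obj C"
  then show "x \<in> Dom C ` Arr C"
    by (intro image_eqI[of _ _ "Ide C x"]) simp_all
qed

lemma is_functor_iff:
  assumes "category C"
  shows "is_functor C D F \<longleftrightarrow>
    (\<forall>x\<in>Obj C. FObj F x \<in> Obj D \<and> FArr F (Ide C x) = Ide D (FObj F x)) \<and>
    (\<forall>f\<in>Arr C. FArr F f \<in> Hom D (FObj F (Dom C f)) (FObj F (Cod C f))) \<and>
    (\<forall>f\<in>Arr C. \<forall>g\<in>Arr C. Dom C g = Cod C f \<longrightarrow>
       FArr F (g \<cdot>\<^bsub>C\<^esub> f) = FArr F g \<cdot>\<^bsub>D\<^esub> FArr F f)"
proof -
  interpret category C by fact
  show ?thesis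
    unfolding is_functor_def ball_Hom ball_composable by blast
qed

lemma is_cone_iff:
  assumes "category J" "category E"
  shows "is_cone J E D x \<tau> \<longleftrightarrow> x \<in> Obj E \<and> (\<forall>j\<in>Obj J. \<tau> j \<in> Hom E x (FObj D j)) \<and>
    (\<forall>f\<in>Arr J. FArr D f \<cdot>\<^bsub>E\<^esub> \<tau> (Dom J f) = \<tau> (Cod J f))"
proof -
  interpret J: category J by fact
  interpret E: category E by fact
  show ?thesis
    unfolding is_cone_def nat_trans_def J.ball_Hom const_func_def by auto
qed

lemma is_cocone_iff:
  assumes "category J" "category E"
  shows "is_cocone J E D x \<tau> \<longleftrightarrow> x \<in> Obj E \<and> (\<forall>j\<in>Obj J. \<tau> j \<in> Hom E (FObj D j) x) \<and>
    (\<forall>f\<in>Arr J. \<tau> (Cod J f) \<cdot>\<^bsub>E\<^esub> FArr D f = \<tau> (Dom J f))"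
proof -
  interpret J: category J by fact
  interpret E: category E by fact
  have *: "Ide E x \<cdot>\<^bsub>E\<^esub> \<tau> j = \<tau> j" if "\<tau> j \<in> Arr E" "Cod E (\<tau> j) = x" for j
    using that by simp
  show ?thesis
    unfolding is_cocone_def nat_trans_def J.ball_Hom const_func_def using * by auto
qed

context surcategory
begin

lemma arity_typing [simp]:
  "x \<in> Obj E \<Longrightarrow> FObj A x \<in> Obj G"
  "f \<in> Arr E \<Longrightarrow> FArr A f \<in> Arr G"
  "f \<in> Arr E \<Longrightarrow> Dom G (FArr A f) = FObj A (Dom E f)"
  "f \<in> Arr E \<Longrightarrow> Cod G (FArr A f) = FObj A (Cod E f)"
  "x \<in> Obj E \<Longrightarrow> FArr A (Ide E x) = Ide G (FObj A x)"
  "f \<in> Arr E \<Longrightarrow> g \<in> Arr E \<Longrightarrow> Dom E g = Cod E f \<Longrightarrow>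
     FArr A (g \<cdot>\<^bsub>E\<^esub> f) = FArr A g \<cdot>\<^bsub>G\<^esub> FArr A f"
  using arity_functor by (simp_all add: is_functor_iff[OF E.category_axioms])

lemma surdiagram_iff:
  "surdiagram E G A J D B \<longleftrightarrow> is_functor J E D \<and> B \<in> Obj G \<and>
     (\<forall>j\<in>Obj J. FObj A (FObj D j) = B) \<and> (\<forall>f\<in>Arr J. FArr A (FArr D f) = Ide G B)"
  by (simp add: surdiagram_def func_eq_def comp_func_def const_func_def)

end

text \<open>A surdiagram fixed once and for all. A cone over an arrow \<open>b\<close> is bundled into a single
  predicate, so that a surlimit is characterised by one universal property quantified over \<open>b\<close>.\<close>

locale diagram_over = surcategory E G A + J: category J
  for E :: "('o, 'm) cat" (structure) and G :: "('p, 'n) cat" and A :: "('o, 'm, 'p, 'n) func"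
    and J :: "('i, 'j) cat" +
  fixes D :: "('i, 'j, 'o, 'm) func" and B :: 'p
  assumes surdiagram: "surdiagram E G A J D B"
begin

lemma base_Obj [simp]: "B \<in> Obj G"
  using surdiagram by (simp add: surdiagram_iff)

lemma diagram_typing [simp]:
  "j \<in> Obj J \<Longrightarrow> FObj D j \<in> Obj E"
  "j \<in> Obj J \<Longrightarrow> FObj A (FObj D j) = B"
  "f \<in> Arr J \<Longrightarrow> FArr D f \<in> Arr E"
  "f \<in> Arr J \<Longrightarrow> Dom E (FArr D f) = FObj D (Dom J f)"
  "f \<in> Arr J \<Longrightarrow> Cod E (FArr D f) = FObj D (Cod J f)"
  "f \<in> Arr J \<Longrightarrow> FArr A (FArr D f) = Ide G B"
  using surdiagram by (simp_all add: surdiagram_iff is_functor_iff[OF J.category_axioms])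

definition cone_over :: "'n \<Rightarrow> 'o \<Rightarrow> ('i \<Rightarrow> 'm) \<Rightarrow> bool" where
  "cone_over b y \<sigma> \<longleftrightarrow> y \<in> Obj E \<and> b \<in> Hom G (FObj A y) B \<and>
     (\<forall>j\<in>Obj J. \<sigma> j \<in> Hom E y (FObj D j) \<and> FArr A (\<sigma> j) = b) \<and>
     (\<forall>f\<in>Arr J. FArr D f \<cdot> \<sigma> (Dom J f) = \<sigma> (Cod J f))"

definition cocone_over :: "'n \<Rightarrow> 'o \<Rightarrow> ('i \<Rightarrow> 'm) \<Rightarrow> bool" where
  "cocone_over b y \<sigma> \<longleftrightarrow> y \<in> Obj E \<and> b \<in> Hom G B (FObj A y) \<and>
     (\<forall>j\<in>Obj J. \<sigma> j \<in> Hom E (FObj D j) y \<and> FArr A (\<sigma> j) = b) \<and>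
     (\<forall>f\<in>Arr J. \<sigma> (Cod J f) \<cdot> FArr D f = \<sigma> (Dom J f))"

lemma surlimit_iff:
  "is_surlimit E G A J D B x \<tau> \<longleftrightarrow> FObj A x = B \<and> cone_over (Ide G B) x \<tau> \<and>
     (\<forall>b y \<sigma>. cone_over b y \<sigma> \<longrightarrow>
       (\<exists>!f. f \<in> Hom E y x \<and> FArr A f = b \<and> (\<forall>j\<in>Obj J. \<tau> j \<cdot> f = \<sigma> j)))"
proof -
  have *: "cone_over b y \<sigma> \<longleftrightarrow>
      is_cone J E D y \<sigma> \<and> b \<in> Hom G (FObj A y) B \<and> (\<forall>j\<in>Obj J. FArr A (\<sigma> j) = b)" for b y \<sigma>
    by (auto simp: cone_over_def is_cone_iff[OF J.category_axioms E.category_axioms])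
  have **: "is_cone J E D y \<sigma> \<Longrightarrow> y \<in> Obj E" for y \<sigma>
    by (simp add: is_cone_def)
  have "(\<forall>y\<in>Obj E. \<forall>b\<in>Hom G (FObj A y) B. \<forall>\<sigma>.
        is_cone J E D y \<sigma> \<and> (\<forall>j\<in>Obj J. FArr A (\<sigma> j) = b) \<longrightarrow> Q y b \<sigma>) \<longleftrightarrow>
      (\<forall>b y \<sigma>. cone_over b y \<sigma> \<longrightarrow> Q y b \<sigma>)" for Q
    unfolding * using ** by blast
  then show ?thesis
    unfolding is_surlimit_def by (auto simp: *)
qed

lemma surcolimit_iff:
  "is_surcolimit E G A J D B x \<tau> \<longleftrightarrow> FObj A x = B \<and> cocone_over (Ide G B) x \<tau> \<and>
     (\<forall>b y \<sigma>. cocone_over b y \<sigma> \<longrightarrow>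
       (\<exists>!f. f \<in> Hom E x y \<and> FArr A f = b \<and> (\<forall>j\<in>Obj J. f \<cdot> \<tau> j = \<sigma> j)))"
proof -
  have *: "cocone_over b y \<sigma> \<longleftrightarrow>
      is_cocone J E D y \<sigma> \<and> b \<in> Hom G B (FObj A y) \<and> (\<forall>j\<in>Obj J. FArr A (\<sigma> j) = b)" for b y \<sigma>
    by (auto simp: cocone_over_def is_cocone_iff[OF J.category_axioms E.category_axioms])
  have **: "is_cocone J E D y \<sigma> \<Longrightarrow> y \<in> Obj E" for y \<sigma>
    by (simp add: is_cocone_def)
  have "(\<forall>y\<in>Obj E. \<forall>b\<in>Hom G B (FObj A y). \<forall>\<sigma>.
        is_cocone J E D y \<sigma> \<and> (\<forall>j\<in>Obj J. FArr A (\<sigma> j) = b) \<longrightarrow> Q y b \<sigma>) \<longleftrightarrow>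
      (\<forall>b y \<sigma>. cocone_over b y \<sigma> \<longrightarrow> Q y b \<sigma>)" for Q
    unfolding * using ** by blast
  then show ?thesis
    unfolding is_surcolimit_def by (auto simp: *)
qed

lemma surlimit_factor:
  assumes "is_surlimit E G A J D B x \<tau>" "cone_over b y \<sigma>"
  obtains f where "f \<in> Hom E y x" "FArr A f = b" "\<And>j. j \<in> Obj J \<Longrightarrow> \<tau> j \<cdot> f = \<sigma> j"
proof -
  have "\<exists>!f. f \<in> Hom E y x \<and> FArr A f = b \<and> (\<forall>j\<in>Obj J. \<tau> j \<cdot> f = \<sigma> j)"
    using assms unfolding surlimit_iff by blast
  then show ?thesis
    using that by blast
qed

lemma surcolimit_factor:
  assumes "is_surcolimit E G A J D B x \<tau>" "cocone_over b y \<sigma>"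
  obtains f where "f \<in> Hom E x y" "FArr A f = b" "\<And>j. j \<in> Obj J \<Longrightarrow> f \<cdot> \<tau> j = \<sigma> j"
proof -
  have "\<exists>!f. f \<in> Hom E x y \<and> FArr A f = b \<and> (\<forall>j\<in>Obj J. f \<cdot> \<tau> j = \<sigma> j)"
    using assms unfolding surcolimit_iff by blast
  then show ?thesis
    using that by blast
qed

text \<open>The legs of a surlimit lie over an identity, so composing them with \<open>f\<close> gives a cone over
  \<open>A f\<close>. Hence two arrows into a surlimit can be compared on the legs once their arities agree; that
  condition has to be checked separately, since the diagram may be empty.\<close>

lemma surlimit_joint_mono:
  assumes lim: "is_surlimit E G A J D B x \<tau>"
    and f: "f \<in> Hom E y x" and g: "g \<in> Hom E y x" and eq: "FArr A f = FArr A g"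
    and comp: "\<And>j. j \<in> Obj J \<Longrightarrow> \<tau> j \<cdot> f = \<tau> j \<cdot> g"
  shows "f = g"
proof -
  have x: "FObj A x = B" "cone_over (Ide G B) x \<tau>"
    using lim by (simp_all add: surlimit_iff)
  have "FArr D u \<cdot> (\<tau> (Dom J u) \<cdot> f) = \<tau> (Cod J u) \<cdot> f" if "u \<in> Arr J" for u
    using that x f E.Cmp_reassoc[of f "\<tau> (Dom J u)" "FArr D u"] by (simp add: cone_over_def)
  then have "cone_over (FArr A f) y (\<lambda>j. \<tau> j \<cdot> f)"
    using x f E.Dom_Obj[of f] by (auto simp: cone_over_def)
  moreover have "\<forall>j\<in>Obj J. \<tau> j \<cdot> g = \<tau> j \<cdot> f"
    using comp by simp
  moreover note lim[unfolded surlimit_iff]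
  ultimately show ?thesis
    using f g eq by (metis (no_types, lifting))
qed

lemma surcolimit_joint_epi:
  assumes colim: "is_surcolimit E G A J D B x \<tau>"
    and f: "f \<in> Hom E x y" and g: "g \<in> Hom E x y" and eq: "FArr A f = FArr A g"
    and comp: "\<And>j. j \<in> Obj J \<Longrightarrow> f \<cdot> \<tau> j = g \<cdot> \<tau> j"
  shows "f = g"
proof -
  have x: "FObj A x = B" "cocone_over (Ide G B) x \<tau>"
    using colim by (simp_all add: surcolimit_iff)
  have "cocone_over (FArr A f) y (\<lambda>j. f \<cdot> \<tau> j)"
    using x f E.Cod_Obj[of f] by (auto simp: cocone_over_def)
  moreover have "\<forall>j\<in>Obj J. g \<cdot> \<tau> j = f \<cdot> \<tau> j"
    using comp by simp
  moreover note colim[unfolded surcolimit_iff]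
  ultimately show ?thesis
    using f g eq by (metis (no_types, lifting))
qed

end

section \<open>Suralgebras\<close>

context surmonad
begin

abbreviation "EMCat \<equiv> EM E T \<eta> \<mu>"

lemma T_typing [simp]:
  "x \<in> Obj E \<Longrightarrow> FObj T x \<in> Obj E"
  "f \<in> Arr E \<Longrightarrow> FArr T f \<in> Arr E"
  "f \<in> Arr E \<Longrightarrow> Dom E (FArr T f) = FObj T (Dom E f)"
  "f \<in> Arr E \<Longrightarrow> Cod E (FArr T f) = FObj T (Cod E f)"
  "x \<in> Obj E \<Longrightarrow> FArr T (Ide E x) = Ide E (FObj T x)"
  using T_functor by (simp_all add: is_functor_iff[OF E.category_axioms])

lemma T_Cmp:
  "f \<in> Arr E \<Longrightarrow> g \<in> Arr E \<Longrightarrow> Dom E g = Cod E f \<Longrightarrow> FArr T (g \<cdot> f) = FArr T g \<cdot> FArr T f"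
  using T_functor by (simp add: is_functor_iff[OF E.category_axioms])

lemma arity_T_simps [simp]:
  "x \<in> Obj E \<Longrightarrow> FObj A (FObj T x) = FObj A x"
  "f \<in> Arr E \<Longrightarrow> FArr A (FArr T f) = FArr A f"
  using arity_T by (simp_all add: func_eq_def comp_func_def)

lemma unit_typing [simp]:
  "x \<in> Obj E \<Longrightarrow> \<eta> x \<in> Arr E"
  "x \<in> Obj E \<Longrightarrow> Dom E (\<eta> x) = x"
  "x \<in> Obj E \<Longrightarrow> Cod E (\<eta> x) = FObj T x"
  using unit_nat by (simp_all add: nat_trans_def id_func_def)

lemma mult_typing [simp]:
  "x \<in> Obj E \<Longrightarrow> \<mu> x \<in> Arr E"
  "x \<in> Obj E \<Longrightarrow> Dom E (\<mu> x) = FObj T (FObj T x)"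
  "x \<in> Obj E \<Longrightarrow> Cod E (\<mu> x) = FObj T x"
  using mult_nat by (simp_all add: nat_trans_def comp_func_def)

lemma unit_natural:
  assumes "f \<in> Arr E" "Dom E f = x" "Cod E f = y"
  shows "\<eta> y \<cdot> f = FArr T f \<cdot> \<eta> x"
  using unit_nat assms E.Dom_Obj[OF assms(1)] E.Cod_Obj[OF assms(1)]
  by (auto simp add: nat_trans_def id_func_def)

lemma mult_natural:
  assumes "f \<in> Arr E" "Dom E f = x" "Cod E f = y"
  shows "\<mu> y \<cdot> FArr T (FArr T f) = FArr T f \<cdot> \<mu> x"
  using mult_nat assms E.Dom_Obj[OF assms(1)] E.Cod_Obj[OF assms(1)]
  by (auto simp add: nat_trans_def comp_func_def)

declare arity_unit [simp] arity_mult [simp]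

lemma EM_simps [simp]:
  "a \<in> Obj EMCat \<longleftrightarrow> is_algebra E T \<eta> \<mu> a"
  "Dom EMCat t = fst t"
  "Cod EMCat t = snd (snd t)"
  "Ide EMCat a = (a, Ide E (fst a), a)"
  "s \<cdot>\<^bsub>EMCat\<^esub> t = (fst t, fst (snd s) \<cdot> fst (snd t), snd (snd s))"
  "FObj (EM_arity A) a = FObj A (fst a)"
  "FArr (EM_arity A) t = FArr A (fst (snd t))"
  by (simp_all add: EM_def EM_arity_def split_beta)

lemma EM_Arr_iff [simp]:
  "t \<in> Arr EMCat \<longleftrightarrow> is_algebra E T \<eta> \<mu> (fst t) \<and> is_algebra E T \<eta> \<mu> (snd (snd t)) \<and>
     fst (snd t) \<in> Hom E (fst (fst t)) (fst (snd (snd t))) \<and>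
     fst (snd t) \<cdot> snd (fst t) = snd (snd (snd t)) \<cdot> FArr T (fst (snd t))"
  by (cases t) (simp add: EM_def)

lemma EM_Hom_eq:
  assumes "t \<in> Hom EMCat a b"
  shows "t = (a, fst (snd t), b)"
  using assms by (cases t) auto

lemma algebraD:
  assumes "is_algebra E T \<eta> \<mu> a"
  shows "fst a \<in> Obj E" "snd a \<in> Arr E" "Dom E (snd a) = FObj T (fst a)" "Cod E (snd a) = fst a"
    "snd a \<cdot> \<eta> (fst a) = Ide E (fst a)" "snd a \<cdot> \<mu> (fst a) = snd a \<cdot> FArr T (snd a)"
  using assms by (auto simp: is_algebra_def)

text \<open>The unit law forces the structure map of a suralgebra to lie over an identity.\<close>

lemma algebra_arity:
  assumes "is_algebra E T \<eta> \<mu> a"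
  shows "FArr A (snd a) = Ide G (FObj A (fst a))"
proof -
  note a = algebraD[OF assms]
  have "FArr A (snd a) = FArr A (snd a \<cdot> \<eta> (fst a))" using a(1-4) by simp
  also have "\<dots> = Ide G (FObj A (fst a))" using a by simp
  finally show ?thesis .
qed



lemma equalizer_factor:
  assumes "is_equalizer E x y f g z e"
    and "q \<in> Arr E" "Dom E q = w" "Cod E q = x" "f \<cdot> q = g \<cdot> q"
  obtains u where "u \<in> Hom E w z" "e \<cdot> u = q"
proof -
  have "\<exists>!u. u \<in> Hom E w z \<and> e \<cdot> u = q"
    using assms E.Dom_Obj[OF assms(2)] unfolding is_equalizer_def by auto
  then show ?thesis using that by blast
qed

lemma equalizer_mono:
  assumes eq: "is_equalizer E x y f g z e" and "f \<in> Hom E x y" "g \<in> Hom E x y"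
    and u: "u \<in> Hom E w z" and v: "v \<in> Hom E w z" and "e \<cdot> u = e \<cdot> v"
  shows "u = v"
proof -
  have e [simp]: "e \<in> Arr E" "Dom E e = z" "Cod E e = x" and fe: "f \<cdot> e = g \<cdot> e"
    using eq by (simp_all add: is_equalizer_def)
  have "(f \<cdot> e) \<cdot> u = (g \<cdot> e) \<cdot> u" by (simp only: fe)
  then have "f \<cdot> (e \<cdot> u) = g \<cdot> (e \<cdot> u)" using assms by simp
  moreover have "e \<cdot> u \<in> Hom E w x" "w \<in> Obj E" using u E.Dom_Obj[of u] by auto
  ultimately have "\<exists>!u'. u' \<in> Hom E w z \<and> e \<cdot> u' = e \<cdot> u"
    using eq unfolding is_equalizer_def by blast
  then show ?thesis
    using u v assms(6) by metis
qed

text \<open>If \<open>e\<close> equalizes two homomorphisms with source \<open>(x, h)\<close>, so does \<open>h \<cdot> T e\<close>, which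
  factors through \<open>e\<close> and thereby gives the structure map on the equalizer. All laws are checked after
  composition with the monomorphism \<open>e\<close>.\<close>

lemma K_equalizer_creation:
  assumes "has_K_equalizers E G A"
  shows "has_K_equalizers EMCat G (EM_arity A)"
  unfolding has_K_equalizers_def
proof (intro ballI impI)
  fix a b s t
  assume "a \<in> Obj EMCat" "b \<in> Obj EMCat" and s: "s \<in> Hom EMCat a b" and t: "t \<in> Hom EMCat a b"
    and arity: "FArr (EM_arity A) s = FArr (EM_arity A) t"
  then have a: "is_algebra E T \<eta> \<mu> a" and b: "is_algebra E T \<eta> \<mu> b" by simp_all
  define x h y k f g where "x = fst a" and "h = snd a" and "y = fst b" and "k = snd b"
    and "f = fst (snd s)" and "g = fst (snd t)"
  note defs = this
  have x [simp]: "x \<in> Obj E" "h \<in> Arr E" "Dom E h = FObj T x" "Cod E h = x"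
      "FArr A h = Ide G (FObj A x)"
    and hx: "h \<cdot> \<eta> x = Ide E x" "h \<cdot> \<mu> x = h \<cdot> FArr T h"
    using algebraD[OF a] algebra_arity[OF a] by (simp_all add: defs)
  have y [simp]: "y \<in> Obj E" "k \<in> Arr E" "Dom E k = FObj T y" "Cod E k = y"
    using algebraD[OF b] by (simp_all add: defs)
  have s_eq: "s = (a, f, b)" and t_eq: "t = (a, g, b)"
    unfolding f_def g_def by (rule EM_Hom_eq[OF s], rule EM_Hom_eq[OF t])
  have f [simp]: "f \<in> Arr E" "Dom E f = x" "Cod E f = y"
    and g [simp]: "g \<in> Arr E" "Dom E g = x" "Cod E g = y"
    and fh: "f \<cdot> h = k \<cdot> FArr T f" and gh: "g \<cdot> h = k \<cdot> FArr T g"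
    using s t by (auto simp: defs)
  have ab: "a = (x, h)" "b = (y, k)" by (simp_all add: defs)
  have "FArr A f = FArr A g"
    using arity by (simp add: defs)
  then obtain z e where eq: "is_equalizer E x y f g z e" and Ae: "FArr A e = Ide G (FObj A x)"
    using assms unfolding has_K_equalizers_def by (metis mem_Hom f g x(1) y(1))
  then have e [simp]: "z \<in> Obj E" "e \<in> Arr E" "Dom E e = z" "Cod E e = x"
    and fe: "f \<cdot> e = g \<cdot> e"
    by (simp_all add: is_equalizer_def)
  have Az: "FObj A z = FObj A x"
    using arity_typing(3)[OF e(2)] Ae by simp
  have mono: "u = v" if "e \<cdot> u = e \<cdot> v" "u \<in> Hom E w z" "v \<in> Hom E w z" for u v w
    by (rule equalizer_mono[OF eq]) (use that in simp_all)
  have "f \<cdot> (h \<cdot> FArr T e) = (f \<cdot> h) \<cdot> FArr T e" by simp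
  also have "\<dots> = k \<cdot> FArr T (f \<cdot> e)" by (simp add: fh T_Cmp)
  also have "\<dots> = (g \<cdot> h) \<cdot> FArr T e" by (simp add: fe gh T_Cmp)
  also have "\<dots> = g \<cdot> (h \<cdot> FArr T e)" by simp
  finally obtain l where l [simp]: "l \<in> Arr E" "Dom E l = FObj T z" "Cod E l = z"
    and el: "e \<cdot> l = h \<cdot> FArr T e"
    using equalizer_factor[OF eq, of "h \<cdot> FArr T e" "FObj T z"] by auto
  have "e \<cdot> (l \<cdot> \<eta> z) = e \<cdot> Ide E z"
  proof -
    have "e \<cdot> (l \<cdot> \<eta> z) = (e \<cdot> l) \<cdot> \<eta> z" by simp
    also have "\<dots> = h \<cdot> (FArr T e \<cdot> \<eta> z)" by (simp add: el)
    also have "\<dots> = (h \<cdot> \<eta> x) \<cdot> e" by (simp add: unit_natural[of e z x, symmetric])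
    also have "\<dots> = e \<cdot> Ide E z" by (simp add: hx)
    finally show ?thesis .
  qed
  then have "l \<cdot> \<eta> z = Ide E z"
    by (rule mono) simp_all
  moreover have "e \<cdot> (l \<cdot> \<mu> z) = e \<cdot> (l \<cdot> FArr T l)"
  proof -
    have "e \<cdot> (l \<cdot> \<mu> z) = (e \<cdot> l) \<cdot> \<mu> z" by simp
    also have "\<dots> = h \<cdot> (FArr T e \<cdot> \<mu> z)" by (simp add: el)
    also have "\<dots> = (h \<cdot> \<mu> x) \<cdot> FArr T (FArr T e)" by (simp add: mult_natural[of e z x, symmetric])
    also have "\<dots> = h \<cdot> FArr T (h \<cdot> FArr T e)" by (simp add: hx T_Cmp)
    also have "\<dots> = h \<cdot> FArr T (e \<cdot> l)" by (simp only: el)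
    also have "\<dots> = (h \<cdot> FArr T e) \<cdot> FArr T l" by (simp add: T_Cmp)
    also have "\<dots> = (e \<cdot> l) \<cdot> FArr T l" by (simp only: el)
    also have "\<dots> = e \<cdot> (l \<cdot> FArr T l)" by simp
    finally show ?thesis .
  qed
  then have "l \<cdot> \<mu> z = l \<cdot> FArr T l"
    by (rule mono) simp_all
  ultimately have alg: "is_algebra E T \<eta> \<mu> (z, l)"
    by (simp add: is_algebra_def)
  have "is_equalizer EMCat a b s t (z, l) ((z, l), e, a)"
    unfolding is_equalizer_def
  proof (intro conjI ballI impI)
    show "((z, l), e, a) \<in> Hom EMCat (z, l) a"
      using a alg el by (simp add: ab)
    show "s \<cdot>\<^bsub>EMCat\<^esub> ((z, l), e, a) = t \<cdot>\<^bsub>EMCat\<^esub> ((z, l), e, a)"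
      by (simp add: s_eq t_eq fe)
  next
    fix c r assume "c \<in> Obj EMCat" and r: "r \<in> Hom EMCat c a"
      and eqr: "s \<cdot>\<^bsub>EMCat\<^esub> r = t \<cdot>\<^bsub>EMCat\<^esub> r"
    define w m q where "w = fst c" and "m = snd c" and "q = fst (snd r)"
    have c: "is_algebra E T \<eta> \<mu> c" using r by auto
    have w [simp]: "w \<in> Obj E" "m \<in> Arr E" "Dom E m = FObj T w" "Cod E m = w"
      using algebraD[OF c] by (simp_all add: w_def m_def)
    have q [simp]: "q \<in> Arr E" "Dom E q = w" "Cod E q = x" and qm: "q \<cdot> m = h \<cdot> FArr T q"
      using r by (auto simp: w_def m_def q_def defs)
    have r_eq: "r = (c, q, a)"
      unfolding q_def by (rule EM_Hom_eq[OF r])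
    have "f \<cdot> q = g \<cdot> q"
      using eqr by (simp add: s_eq t_eq r_eq)
    then obtain u where u [simp]: "u \<in> Arr E" "Dom E u = w" "Cod E u = z" and eu: "e \<cdot> u = q"
      using equalizer_factor[OF eq, of q w] by auto
    have "e \<cdot> (u \<cdot> m) = e \<cdot> (l \<cdot> FArr T u)"
    proof -
      have "e \<cdot> (u \<cdot> m) = (e \<cdot> u) \<cdot> m" by simp
      also have "\<dots> = h \<cdot> FArr T (e \<cdot> u)" by (simp only: eu qm)
      also have "\<dots> = (h \<cdot> FArr T e) \<cdot> FArr T u" by (simp add: T_Cmp)
      also have "\<dots> = (e \<cdot> l) \<cdot> FArr T u" by (simp only: el)
      also have "\<dots> = e \<cdot> (l \<cdot> FArr T u)" by simp
      finally show ?thesis .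
    qed
    then have um: "u \<cdot> m = l \<cdot> FArr T u"
      by (rule mono) simp_all
    show "\<exists>!t. t \<in> Hom EMCat c (z, l) \<and> ((z, l), e, a) \<cdot>\<^bsub>EMCat\<^esub> t = r"
    proof (rule ex1I[of _ "(c, u, (z, l))"])
      show "(c, u, (z, l)) \<in> Hom EMCat c (z, l) \<and> ((z, l), e, a) \<cdot>\<^bsub>EMCat\<^esub> (c, u, (z, l)) = r"
        using um c alg eu by (simp add: r_eq w_def[symmetric] m_def[symmetric])
    next
      fix t' assume t': "t' \<in> Hom EMCat c (z, l) \<and> ((z, l), e, a) \<cdot>\<^bsub>EMCat\<^esub> t' = r"
      then obtain u' where t'_eq: "t' = (c, u', (z, l))"
        using EM_Hom_eq by blast
      have "u' = u"
        by (rule mono[of _ _ w]) (use t' in \<open>simp_all add: t'_eq r_eq eu w_def[symmetric]\<close>)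
      then show "t' = (c, u, (z, l))"
        by (simp add: t'_eq)
    qed
  qed (use alg in simp)
  moreover have "FArr (EM_arity A) ((z, l), e, a) = Ide G (FObj (EM_arity A) a)"
    using Ae by (simp add: ab)
  ultimately show "\<exists>k e. is_equalizer EMCat a b s t k e \<and>
      FArr (EM_arity A) e = Ide G (FObj (EM_arity A) a)"
    by blast
qed

end

section \<open>Diagrams of suralgebras and their limits\<close>

text \<open>A surdiagram of suralgebras \<open>(X j, h j)\<close> over \<open>B\<close> with underlying transition maps \<open>d f\<close>. It
  is a surdiagram twice over, in the Eilenberg--Moore category (prefix \<open>EM\<close>) and, through the
  underlying objects, in \<open>E\<close> (prefix \<open>U\<close>).\<close>

locale algebra_diagram = surmonad E G A T \<eta> \<mu> + J: category J
  for E :: "('o, 'm) cat" (structure) and G :: "('p, 'n) cat" and A :: "('o, 'm, 'p, 'n) func"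
    and T \<eta> \<mu> and J :: "('i, 'j) cat" +
  fixes D :: "('i, 'j, 'o \<times> 'm, ('o \<times> 'm) \<times> 'm \<times> ('o \<times> 'm)) func" and B :: 'p
  assumes algebra_surdiagram: "surdiagram (EM E T \<eta> \<mu>) G (EM_arity A) J D B"
begin

abbreviation "X j \<equiv> fst (FObj D j)"
abbreviation "h j \<equiv> snd (FObj D j)"
abbreviation "d f \<equiv> fst (snd (FArr D f))"

definition carrier :: "('i, 'j, 'o, 'm) func" where
  "carrier = \<lparr>FObj = X, FArr = d\<rparr>"

lemma carrier_simps [simp]: "FObj carrier j = X j" "FArr carrier f = d f"
  by (simp_all add: carrier_def)

sublocale EM: diagram_over EMCat G "EM_arity A" J D B
  using surcategory_EM algebra_surdiagram J.category_axioms
  by (simp add: diagram_over_def diagram_over_axioms_def)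

lemma algebra_at: "j \<in> Obj J \<Longrightarrow> is_algebra E T \<eta> \<mu> (FObj D j)"
  using EM.diagram_typing(1)[of j] by simp

lemma diagram_ends [simp]:
  assumes "f \<in> Arr J"
  shows "fst (FArr D f) = FObj D (Dom J f)" "snd (snd (FArr D f)) = FObj D (Cod J f)"
  using EM.diagram_typing(4,5)[OF assms] by simp_all

lemma structure_typing [simp]:
  assumes "j \<in> Obj J"
  shows "X j \<in> Obj E" "FObj A (X j) = B"
    "h j \<in> Arr E" "Dom E (h j) = FObj T (X j)" "Cod E (h j) = X j" "FArr A (h j) = Ide G B"
  using algebraD[OF algebra_at[OF assms]] algebra_arity[OF algebra_at[OF assms]]
    EM.diagram_typing(2)[OF assms] by simp_all

lemma structure_laws:
  assumes "j \<in> Obj J"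
  shows "h j \<cdot> \<eta> (X j) = Ide E (X j)" "h j \<cdot> \<mu> (X j) = h j \<cdot> FArr T (h j)"
  using algebraD[OF algebra_at[OF assms]] by simp_all

lemma transition_typing [simp]:
  assumes "f \<in> Arr J"
  shows "d f \<in> Arr E" "Dom E (d f) = X (Dom J f)" "Cod E (d f) = X (Cod J f)"
    "FArr A (d f) = Ide G B"
  using EM.diagram_typing(3-6)[OF assms] by auto

lemma transition_homomorphism:
  assumes "f \<in> Arr J"
  shows "d f \<cdot> h (Dom J f) = h (Cod J f) \<cdot> FArr T (d f)"
  using EM.diagram_typing(3-5)[OF assms] by auto

sublocale U: diagram_over E G A J carrier B
proof unfold_locales
  have D: "is_functor J EMCat D"
    using algebra_surdiagram by (simp add: EM.surdiagram_iff)
  then have "d (Ide J j) = Ide E (X j)" if "j \<in> Obj J" for j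
    using that unfolding is_functor_iff[OF J.category_axioms] by simp
  moreover have "d (g \<cdot>\<^bsub>J\<^esub> f) = d g \<cdot> d f" if "f \<in> Arr J" "g \<in> Arr J" "Dom J g = Cod J f" for f g
    using D that unfolding is_functor_iff[OF J.category_axioms] by simp
  ultimately have "is_functor J E carrier"
    unfolding is_functor_iff[OF J.category_axioms] by simp
  then show "surdiagram E G A J carrier B"
    by (simp add: surdiagram_iff)
qed

lemma EM_cone_iff:
  "EM.cone_over b y \<sigma> \<longleftrightarrow> is_algebra E T \<eta> \<mu> y \<and> U.cone_over b (fst y) (\<lambda>j. fst (snd (\<sigma> j))) \<and>
     (\<forall>j\<in>Obj J. fst (\<sigma> j) = y \<and> snd (snd (\<sigma> j)) = FObj D j \<and>
        fst (snd (\<sigma> j)) \<cdot> snd y = h j \<cdot> FArr T (fst (snd (\<sigma> j))))"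
    (is "_ \<longleftrightarrow> _ \<and> _ \<and> (\<forall>j\<in>Obj J. ?hom j)")
proof (cases "is_algebra E T \<eta> \<mu> y \<and> (\<forall>j\<in>Obj J. ?hom j)")
  case True
  then have y: "is_algebra E T \<eta> \<mu> y" and hom: "\<And>j. j \<in> Obj J \<Longrightarrow> ?hom j" by blast+
  have "\<sigma> j \<in> Hom EMCat y (FObj D j) \<longleftrightarrow> fst (snd (\<sigma> j)) \<in> Hom E (fst y) (X j)"
    if "j \<in> Obj J" for j
    using hom[OF that] algebra_at[OF that] y by auto
  moreover have "FArr D f \<cdot>\<^bsub>EMCat\<^esub> \<sigma> (Dom J f) = \<sigma> (Cod J f) \<longleftrightarrow>
      d f \<cdot> fst (snd (\<sigma> (Dom J f))) = fst (snd (\<sigma> (Cod J f)))" if "f \<in> Arr J" for f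
    using hom[OF J.Dom_Obj[OF that]] hom[OF J.Cod_Obj[OF that]] that
    by (cases "\<sigma> (Cod J f)") auto
  ultimately show ?thesis
    using y hom algebraD(1)[OF y] unfolding EM.cone_over_def U.cone_over_def by simp
next
  case False
  have "is_algebra E T \<eta> \<mu> y \<and> (\<forall>j\<in>Obj J. ?hom j)" if "EM.cone_over b y \<sigma>"
    using that by (auto simp: EM.cone_over_def)
  with False show ?thesis by blast
qed

lemma EM_cocone_iff:
  "EM.cocone_over b y \<sigma> \<longleftrightarrow> is_algebra E T \<eta> \<mu> y \<and> U.cocone_over b (fst y) (\<lambda>j. fst (snd (\<sigma> j))) \<and>
     (\<forall>j\<in>Obj J. fst (\<sigma> j) = FObj D j \<and> snd (snd (\<sigma> j)) = y \<and>
        fst (snd (\<sigma> j)) \<cdot> h j = snd y \<cdot> FArr T (fst (snd (\<sigma> j))))"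
    (is "_ \<longleftrightarrow> _ \<and> _ \<and> (\<forall>j\<in>Obj J. ?hom j)")
proof (cases "is_algebra E T \<eta> \<mu> y \<and> (\<forall>j\<in>Obj J. ?hom j)")
  case True
  then have y: "is_algebra E T \<eta> \<mu> y" and hom: "\<And>j. j \<in> Obj J \<Longrightarrow> ?hom j" by blast+
  have "\<sigma> j \<in> Hom EMCat (FObj D j) y \<longleftrightarrow> fst (snd (\<sigma> j)) \<in> Hom E (X j) (fst y)"
    if "j \<in> Obj J" for j
    using hom[OF that] algebra_at[OF that] y by auto
  moreover have "\<sigma> (Cod J f) \<cdot>\<^bsub>EMCat\<^esub> FArr D f = \<sigma> (Dom J f) \<longleftrightarrow>
      fst (snd (\<sigma> (Cod J f))) \<cdot> d f = fst (snd (\<sigma> (Dom J f)))" if "f \<in> Arr J" for f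
    using hom[OF J.Dom_Obj[OF that]] hom[OF J.Cod_Obj[OF that]] that
    by (cases "\<sigma> (Dom J f)") auto
  ultimately show ?thesis
    using y hom algebraD(1)[OF y] unfolding EM.cocone_over_def U.cocone_over_def by simp
next
  case False
  have "is_algebra E T \<eta> \<mu> y \<and> (\<forall>j\<in>Obj J. ?hom j)" if "EM.cocone_over b y \<sigma>"
    using that by (auto simp: EM.cocone_over_def)
  with False show ?thesis by blast
qed

text \<open>The structure map on the limit of the underlying objects is forced: it must make the legs
  homomorphisms, and the legs are jointly monic over each arrow of \<open>G\<close>.\<close>

lemma surlimit_creation:
  assumes lim: "is_surlimit E G A J carrier B x \<tau>"
  shows "\<exists>x \<tau>. is_surlimit EMCat G (EM_arity A) J D B x \<tau>"
proof -
  have cone: "U.cone_over (Ide G B) x \<tau>" and Ax: "FObj A x = B"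
    using lim by (simp_all add: U.surlimit_iff)
  then have x [simp]: "x \<in> Obj E"
    and \<tau> [simp]: "\<And>j. j \<in> Obj J \<Longrightarrow> \<tau> j \<in> Arr E" "\<And>j. j \<in> Obj J \<Longrightarrow> Dom E (\<tau> j) = x"
      "\<And>j. j \<in> Obj J \<Longrightarrow> Cod E (\<tau> j) = X j" "\<And>j. j \<in> Obj J \<Longrightarrow> FArr A (\<tau> j) = Ide G B"
    and d\<tau>: "\<And>f. f \<in> Arr J \<Longrightarrow> d f \<cdot> \<tau> (Dom J f) = \<tau> (Cod J f)"
    by (simp_all add: U.cone_over_def)
  note Ax [simp]
  have "d f \<cdot> (h (Dom J f) \<cdot> FArr T (\<tau> (Dom J f))) = h (Cod J f) \<cdot> FArr T (\<tau> (Cod J f))"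
    if f: "f \<in> Arr J" for f
  proof -
    have "d f \<cdot> (h (Dom J f) \<cdot> FArr T (\<tau> (Dom J f))) = (d f \<cdot> h (Dom J f)) \<cdot> FArr T (\<tau> (Dom J f))"
      using f by simp
    also have "\<dots> = h (Cod J f) \<cdot> (FArr T (d f) \<cdot> FArr T (\<tau> (Dom J f)))"
      using f by (simp add: transition_homomorphism)
    also have "\<dots> = h (Cod J f) \<cdot> FArr T (\<tau> (Cod J f))"
      using f by (simp add: T_Cmp[symmetric] d\<tau>)
    finally show ?thesis .
  qed
  then have "U.cone_over (Ide G B) (FObj T x) (\<lambda>j. h j \<cdot> FArr T (\<tau> j))"
    by (simp add: U.cone_over_def)
  from U.surlimit_factor[OF lim this]
  obtain k where k [simp]: "k \<in> Arr E" "Dom E k = FObj T x" "Cod E k = x" "FArr A k = Ide G B"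
    and \<tau>k: "\<And>j. j \<in> Obj J \<Longrightarrow> \<tau> j \<cdot> k = h j \<cdot> FArr T (\<tau> j)"
    by auto
  have "k \<cdot> \<eta> x = Ide E x"
  proof (rule U.surlimit_joint_mono[OF lim])
    fix j assume j: "j \<in> Obj J"
    have "\<tau> j \<cdot> (k \<cdot> \<eta> x) = (\<tau> j \<cdot> k) \<cdot> \<eta> x" using j by simp
    also have "\<dots> = h j \<cdot> (FArr T (\<tau> j) \<cdot> \<eta> x)" using j by (simp add: \<tau>k)
    also have "\<dots> = (h j \<cdot> \<eta> (X j)) \<cdot> \<tau> j"
      using j by (simp add: unit_natural[symmetric])
    also have "\<dots> = \<tau> j \<cdot> Ide E x" using j by (simp add: structure_laws)
    finally show "\<tau> j \<cdot> (k \<cdot> \<eta> x) = \<tau> j \<cdot> Ide E x" .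
  qed simp_all
  moreover have "k \<cdot> \<mu> x = k \<cdot> FArr T k"
  proof (rule U.surlimit_joint_mono[OF lim])
    fix j assume j: "j \<in> Obj J"
    have "\<tau> j \<cdot> (k \<cdot> \<mu> x) = (\<tau> j \<cdot> k) \<cdot> \<mu> x" using j by simp
    also have "\<dots> = h j \<cdot> (FArr T (\<tau> j) \<cdot> \<mu> x)" using j by (simp add: \<tau>k)
    also have "\<dots> = (h j \<cdot> \<mu> (X j)) \<cdot> FArr T (FArr T (\<tau> j))"
      using j by (simp add: mult_natural[symmetric])
    also have "\<dots> = h j \<cdot> FArr T (h j \<cdot> FArr T (\<tau> j))" using j by (simp add: structure_laws T_Cmp)
    also have "\<dots> = h j \<cdot> FArr T (\<tau> j \<cdot> k)" using j by (simp only: \<tau>k)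
    also have "\<dots> = (h j \<cdot> FArr T (\<tau> j)) \<cdot> FArr T k" using j by (simp add: T_Cmp)
    also have "\<dots> = (\<tau> j \<cdot> k) \<cdot> FArr T k" using j by (simp only: \<tau>k)
    also have "\<dots> = \<tau> j \<cdot> (k \<cdot> FArr T k)" using j by simp
    finally show "\<tau> j \<cdot> (k \<cdot> \<mu> x) = \<tau> j \<cdot> (k \<cdot> FArr T k)" .
  qed simp_all
  ultimately have alg: "is_algebra E T \<eta> \<mu> (x, k)"
    by (simp add: is_algebra_def)
  have "is_surlimit EMCat G (EM_arity A) J D B (x, k) (\<lambda>j. ((x, k), \<tau> j, FObj D j))"
    unfolding EM.surlimit_iff
  proof (intro conjI allI impI)
    show "EM.cone_over (Ide G B) (x, k) (\<lambda>j. ((x, k), \<tau> j, FObj D j))"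
      using alg cone by (simp add: EM_cone_iff \<tau>k)
  next
    fix b y \<sigma>
    assume \<sigma>: "EM.cone_over b y \<sigma>"
    let ?s = "\<lambda>j. fst (snd (\<sigma> j))"
    have y: "is_algebra E T \<eta> \<mu> y" and s: "U.cone_over b (fst y) ?s"
      and hom: "\<And>j. j \<in> Obj J \<Longrightarrow> ?s j \<cdot> snd y = h j \<cdot> FArr T (?s j)"
      and \<sigma>_eq: "\<And>j. j \<in> Obj J \<Longrightarrow> fst (\<sigma> j) = y \<and> snd (snd (\<sigma> j)) = FObj D j"
      using \<sigma> unfolding EM_cone_iff by blast+
    note [simp] = algebraD(1-4)[OF y] algebra_arity[OF y]
    from U.surlimit_factor[OF lim s]
    obtain f where f [simp]: "f \<in> Arr E" "Dom E f = fst y" "Cod E f = x" "FArr A f = b"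
      and \<tau>f: "\<And>j. j \<in> Obj J \<Longrightarrow> \<tau> j \<cdot> f = ?s j"
      by auto
    have b [simp]: "b \<in> Arr G" "Dom G b = FObj A (fst y)" "Cod G b = B"
      using s by (simp_all add: U.cone_over_def)
    have "f \<cdot> snd y = k \<cdot> FArr T f"
    proof (rule U.surlimit_joint_mono[OF lim])
      fix j assume j: "j \<in> Obj J"
      have "\<tau> j \<cdot> (f \<cdot> snd y) = (\<tau> j \<cdot> f) \<cdot> snd y" using j by simp
      also have "\<dots> = h j \<cdot> FArr T (\<tau> j \<cdot> f)" using j by (simp only: \<tau>f hom)
      also have "\<dots> = (h j \<cdot> FArr T (\<tau> j)) \<cdot> FArr T f" using j by (simp add: T_Cmp)
      also have "\<dots> = (\<tau> j \<cdot> k) \<cdot> FArr T f" using j by (simp only: \<tau>k)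
      also have "\<dots> = \<tau> j \<cdot> (k \<cdot> FArr T f)" using j by simp
      finally show "\<tau> j \<cdot> (f \<cdot> snd y) = \<tau> j \<cdot> (k \<cdot> FArr T f)" .
    qed simp_all
    then have "(y, f, (x, k)) \<in> Hom EMCat y (x, k)"
      using alg y by simp
    moreover have "((x, k), \<tau> j, FObj D j) \<cdot>\<^bsub>EMCat\<^esub> (y, f, (x, k)) = \<sigma> j" if "j \<in> Obj J" for j
      using \<tau>f[OF that] \<sigma>_eq[OF that] by (simp add: prod_eq_iff)
    moreover have "t = (y, f, (x, k))"
      if "t \<in> Hom EMCat y (x, k)" "FArr (EM_arity A) t = b"
        "\<forall>j\<in>Obj J. ((x, k), \<tau> j, FObj D j) \<cdot>\<^bsub>EMCat\<^esub> t = \<sigma> j" for t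
    proof -
      have "fst (snd t) = f"
      proof (rule U.surlimit_joint_mono[OF lim])
        fix j assume j: "j \<in> Obj J"
        then have "\<sigma> j = ((x, k), \<tau> j, FObj D j) \<cdot>\<^bsub>EMCat\<^esub> t" using that(3) by simp
        then show "\<tau> j \<cdot> fst (snd t) = \<tau> j \<cdot> f" using \<tau>f[OF j] by simp
      qed (use that in auto)
      then show ?thesis
        using EM_Hom_eq[OF that(1)] by metis
    qed
    moreover have "FArr (EM_arity A) (y, f, (x, k)) = b"
      by simp
    ultimately show "\<exists>!t. t \<in> Hom EMCat y (x, k) \<and> FArr (EM_arity A) t = b \<and>
        (\<forall>j\<in>Obj J. ((x, k), \<tau> j, FObj D j) \<cdot>\<^bsub>EMCat\<^esub> t = \<sigma> j)"
      by blast
  qed simp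
  then show ?thesis by blast
qed

end


section \<open>Surcolimits by generators and relations\<close>

lemma card_of_Times_ordLess_infinite:
  assumes C: "infinite C" and AB: "|A| <o |C|" "|B| <o |C|"
  shows "|A \<times> B| <o |C|"
proof -
  let ?S = "A <+> B"
  have S: "|?S| <o |C|"
    using assms by (rule card_of_Plus_ordLess_infinite)
  have "|A \<times> B| \<le>o |?S \<times> ?S|"
    using card_of_Times_mono1[OF card_of_Plus1] card_of_Times_mono2[OF card_of_Plus2]
    by (rule ordLeq_transitive)
  also have "|?S \<times> ?S| <o |C|"
  proof (cases "finite ?S")
    case True
    then have "finite (?S \<times> ?S)" by blast
    then show ?thesis
      using C by (meson card_of_Well_order card_of_ordLeq_finite not_ordLeq_iff_ordLess)
  next
    case False
    then show ?thesis using card_of_Times_same_infinite S by (blast intro: ordIso_ordLess_trans)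
  qed
  finally show ?thesis .
qed

text \<open>The shape of a presentation: one object for each generator, one for each relation, and for each
  relation two arrows to the generators that it relates. Objects are identified with their identities,
  and no two arrows other than identities are composable, so composition only has to discard an
  identity.\<close>

datatype ('i, 'r) span = Gen 'i | Rel 'r | Lft 'r | Rgt 'r

definition span_cat ::
    "'i set \<Rightarrow> 'r set \<Rightarrow> ('r \<Rightarrow> 'i) \<Rightarrow> ('r \<Rightarrow> 'i) \<Rightarrow> (('i, 'r) span, ('i, 'r) span) cat" where
  "span_cat I R s t =
    \<lparr>Obj = Gen ` I \<union> Rel ` R,
     Arr = Gen ` I \<union> Rel ` R \<union> (Lft ` R \<union> Rgt ` R),
     Dom = (\<lambda>a. case a of Lft r \<Rightarrow> Rel r | Rgt r \<Rightarrow> Rel r | _ \<Rightarrow> a),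
     Cod = (\<lambda>a. case a of Lft r \<Rightarrow> Gen (s r) | Rgt r \<Rightarrow> Gen (t r) | _ \<Rightarrow> a),
     Ide = (\<lambda>x. x),
     Cmp = (\<lambda>g f. case f of Gen _ \<Rightarrow> g | Rel _ \<Rightarrow> g | _ \<Rightarrow> f)\<rparr>"

lemma category_span_cat:
  assumes "\<And>r. r \<in> R \<Longrightarrow> s r \<in> I \<and> t r \<in> I"
  shows "category (span_cat I R s t)"
  using assms by unfold_locales (auto simp: span_cat_def split: span.splits)

context surcategory
begin

text \<open>Surcocompleteness speaks of index categories with objects and arrows in \<open>'u\<close>. Any category
  with fewer arrows than \<open>'u\<close> has elements is isomorphic to one of them: code its arrows by an
  injection, and its objects by the codes of their identities.\<close>

lemma surcolimit_any_index:
  fixes J :: "('i, 'j) cat"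
  assumes cocomplete: "surcocomplete TYPE('u) E G A"
    and J: "category J" "|Arr J| <o |UNIV :: 'u set|" and D: "surdiagram E G A J D B"
  shows "\<exists>x \<tau>. is_surcolimit E G A J D B x \<tau>"
proof -
  interpret J: category J by fact
  interpret D: diagram_over E G A J D B
    using D by unfold_locales
  obtain e :: "'j \<Rightarrow> 'u" where e: "inj_on e (Arr J)"
    using ordLess_imp_ordLeq[OF J(2)] unfolding card_of_ordLeq[symmetric] by blast
  define r where "r = inv_into (Arr J) e"
  define ob where "ob j = e (Ide J j)" for j
  have r [simp]: "r (e f) = f" if "f \<in> Arr J" for f
    using e that by (simp add: r_def)
  have ob [simp]: "r (ob j) = Ide J j" if "j \<in> Obj J" for j
    using that by (simp add: ob_def)
  have ob_eq [simp]: "ob i = ob j \<longleftrightarrow> i = j" if "i \<in> Obj J" "j \<in> Obj J" for i j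
    using that ob by (metis J.Ide_typing(2))
  define J' :: "('u, 'u) cat" where "J' = \<lparr>Obj = ob ` Obj J, Arr = e ` Arr J,
    Dom = (\<lambda>u. ob (Dom J (r u))), Cod = (\<lambda>u. ob (Cod J (r u))), Ide = (\<lambda>u. u),
    Cmp = (\<lambda>v u. e (r v \<cdot>\<^bsub>J\<^esub> r u))\<rparr>"
  have J'_simps [simp]: "Obj J' = ob ` Obj J" "Arr J' = e ` Arr J"
    "Dom J' u = ob (Dom J (r u))" "Cod J' u = ob (Cod J (r u))" "Ide J' u = u"
    "v \<cdot>\<^bsub>J'\<^esub> u = e (r v \<cdot>\<^bsub>J\<^esub> r u)" for u v
    by (simp_all add: J'_def)
  have "category J'"
    by unfold_locales (auto simp: ob_def[symmetric], auto simp: ob_def)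
  moreover have "|Arr J'| <o |UNIV :: 'u set|"
    using ordLeq_ordLess_trans[OF card_of_image J(2)] by simp
  ultimately have J': "category J'" "small_category J'"
    by (simp_all add: small_category_def)
  define D' where "D' = \<lparr>FObj = (\<lambda>u. FObj D (Dom J (r u))), FArr = (\<lambda>u. FArr D (r u))\<rparr>"
  have "is_functor J E D"
    using D by (simp add: surdiagram_iff)
  then have "is_functor J' E D'"
    unfolding is_functor_iff[OF J'(1)] is_functor_iff[OF J(1)] by (auto simp: D'_def)
  then have "surdiagram E G A J' D' B"
    by (auto simp: surdiagram_iff D'_def)
  then interpret D': diagram_over E G A J' D' B
    using J'(1) surcategory_axioms by (simp add: diagram_over_def diagram_over_axioms_def)
  obtain x \<tau> where colim: "is_surcolimit E G A J' D' B x \<tau>"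
    using cocomplete J'(2) D'.surdiagram unfolding surcocomplete_def by blast
  have pull: "D.cocone_over b y (\<lambda>j. \<sigma> (ob j))" if "D'.cocone_over b y \<sigma>" for b y \<sigma>
    using that by (simp add: D.cocone_over_def D'.cocone_over_def) (simp add: D'_def)
  have push: "D'.cocone_over b y (\<lambda>u. \<sigma> (Dom J (r u)))" if "D.cocone_over b y \<sigma>" for b y \<sigma>
    using that by (simp add: D.cocone_over_def D'.cocone_over_def) (simp add: D'_def)
  have "is_surcolimit E G A J D B x (\<lambda>j. \<tau> (ob j))"
    unfolding D.surcolimit_iff
  proof (intro conjI allI impI)
    show "FObj A x = B" "D.cocone_over (Ide G B) x (\<lambda>j. \<tau> (ob j))"
      using colim pull by (simp_all add: D'.surcolimit_iff)
  next
    fix b y \<sigma> assume "D.cocone_over b y \<sigma>"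
    from push[OF this]
    have "\<exists>!f. f \<in> Hom E x y \<and> FArr A f = b \<and> (\<forall>u\<in>Obj J'. f \<cdot>\<^bsub>E\<^esub> \<tau> u = \<sigma> (Dom J (r u)))"
      using colim unfolding D'.surcolimit_iff by blast
    then show "\<exists>!f. f \<in> Hom E x y \<and> FArr A f = b \<and> (\<forall>j\<in>Obj J. f \<cdot>\<^bsub>E\<^esub> \<tau> (ob j) = \<sigma> j)"
      by simp
  qed
  then show ?thesis by blast
qed

text \<open>A relation \<open>r\<close> with source \<open>Q r\<close> equates \<open>u r\<close>, followed by the generator \<open>s r\<close>, with
  \<open>v r\<close>, followed by the generator \<open>t r\<close>. A cocone on the span diagram is determined by its values at
  the generators, and the values at the relations exist precisely if the relations hold.\<close>

lemma generators_and_relations: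
  fixes I :: "'i set" and R :: "'r set"
  assumes cocomplete: "surcocomplete TYPE('u) E G A" and inf: "infinite (UNIV :: 'u set)"
    and small: "|I| <o |UNIV :: 'u set|" "|R| <o |UNIV :: 'u set|"
    and B [simp]: "B \<in> Obj G"
    and P: "\<And>i. i \<in> I \<Longrightarrow> P i \<in> Obj E \<and> FObj A (P i) = B"
    and ends: "\<And>r. r \<in> R \<Longrightarrow> s r \<in> I \<and> t r \<in> I"
    and u: "\<And>r. r \<in> R \<Longrightarrow> u r \<in> Hom E (Q r) (P (s r)) \<and> FArr A (u r) = Ide G B"
    and v: "\<And>r. r \<in> R \<Longrightarrow> v r \<in> Hom E (Q r) (P (t r)) \<and> FArr A (v r) = Ide G B"
  shows "\<exists>x p. x \<in> Obj E \<and> FObj A x = B \<and>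
    (\<forall>i\<in>I. p i \<in> Hom E (P i) x \<and> FArr A (p i) = Ide G B) \<and>
    (\<forall>r\<in>R. p (s r) \<cdot>\<^bsub>E\<^esub> u r = p (t r) \<cdot>\<^bsub>E\<^esub> v r) \<and>
    (\<forall>b y q. y \<in> Obj E \<and> b \<in> Hom G B (FObj A y) \<and>
       (\<forall>i\<in>I. q i \<in> Hom E (P i) y \<and> FArr A (q i) = b) \<and>
       (\<forall>r\<in>R. q (s r) \<cdot>\<^bsub>E\<^esub> u r = q (t r) \<cdot>\<^bsub>E\<^esub> v r) \<longrightarrow>
       (\<exists>!f. f \<in> Hom E x y \<and> FArr A f = b \<and> (\<forall>i\<in>I. f \<cdot>\<^bsub>E\<^esub> p i = q i)))"
proof -
  let ?J = "span_cat I R s t"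
  interpret J: category ?J
    using ends by (rule category_span_cat)
  define D where "D = \<lparr>FObj = (\<lambda>a. case a of Gen i \<Rightarrow> P i | Rel r \<Rightarrow> Q r),
    FArr = (\<lambda>a. case a of Gen i \<Rightarrow> Ide E (P i) | Rel r \<Rightarrow> Ide E (Q r) | Lft r \<Rightarrow> u r | Rgt r \<Rightarrow> v r)\<rparr>"
  note [simp] = u[simplified] v[simplified] P ends
  have Q [simp]: "Q r \<in> Obj E" "FObj A (Q r) = B" if "r \<in> R" for r
    using E.Dom_Obj[of "u r"] arity_typing(3)[of "u r"] that by simp_all
  have "is_functor ?J E D"
    unfolding is_functor_iff[OF J.category_axioms] by (auto simp: D_def span_cat_def)
  then have D: "surdiagram E G A ?J D B"
    unfolding surdiagram_iff by (auto simp: D_def span_cat_def)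
  interpret D: diagram_over E G A ?J D B
    using D by unfold_locales
  have "|Arr ?J| <o |UNIV :: 'u set|"
    using small unfolding span_cat_def
    by (auto intro!: card_of_Un_ordLess_infinite[OF inf] ordLeq_ordLess_trans[OF card_of_image])
  from surcolimit_any_index[OF cocomplete J.category_axioms this D]
  obtain x \<tau> where colim: "is_surcolimit E G A ?J D B x \<tau>"
    by blast
  have cocone: "D.cocone_over b y \<sigma> \<longleftrightarrow> y \<in> Obj E \<and> b \<in> Hom G B (FObj A y) \<and>
      (\<forall>i\<in>I. \<sigma> (Gen i) \<in> Hom E (P i) y \<and> FArr A (\<sigma> (Gen i)) = b) \<and>
      (\<forall>r\<in>R. \<sigma> (Gen (s r)) \<cdot>\<^bsub>E\<^esub> u r = \<sigma> (Rel r) \<and> \<sigma> (Gen (t r)) \<cdot>\<^bsub>E\<^esub> v r = \<sigma> (Rel r))" for b y \<sigma>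
  proof (rule iffI)
    assume "D.cocone_over b y \<sigma>"
    then show "y \<in> Obj E \<and> b \<in> Hom G B (FObj A y) \<and>
      (\<forall>i\<in>I. \<sigma> (Gen i) \<in> Hom E (P i) y \<and> FArr A (\<sigma> (Gen i)) = b) \<and>
      (\<forall>r\<in>R. \<sigma> (Gen (s r)) \<cdot>\<^bsub>E\<^esub> u r = \<sigma> (Rel r) \<and> \<sigma> (Gen (t r)) \<cdot>\<^bsub>E\<^esub> v r = \<sigma> (Rel r))"
      unfolding D.cocone_over_def by (auto simp: D_def span_cat_def ball_Un)
  next
    assume *: "y \<in> Obj E \<and> b \<in> Hom G B (FObj A y) \<and>
      (\<forall>i\<in>I. \<sigma> (Gen i) \<in> Hom E (P i) y \<and> FArr A (\<sigma> (Gen i)) = b) \<and>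
      (\<forall>r\<in>R. \<sigma> (Gen (s r)) \<cdot>\<^bsub>E\<^esub> u r = \<sigma> (Rel r) \<and> \<sigma> (Gen (t r)) \<cdot>\<^bsub>E\<^esub> v r = \<sigma> (Rel r))"
    have "\<sigma> (Rel r) \<in> Hom E (Q r) y \<and> FArr A (\<sigma> (Rel r)) = b" if "r \<in> R" for r
    proof -
      have "\<sigma> (Gen (s r)) \<cdot>\<^bsub>E\<^esub> u r \<in> Hom E (Q r) y \<and> FArr A (\<sigma> (Gen (s r)) \<cdot>\<^bsub>E\<^esub> u r) = b"
        using *[THEN conjunct1] *[THEN conjunct2, THEN conjunct1]
          *[THEN conjunct2, THEN conjunct2, THEN conjunct1] that by simp
      moreover have "\<sigma> (Gen (s r)) \<cdot>\<^bsub>E\<^esub> u r = \<sigma> (Rel r)" using * that by blast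
      ultimately show ?thesis by simp
    qed
    with * show "D.cocone_over b y \<sigma>"
      unfolding D.cocone_over_def by (auto simp: D_def span_cat_def)
  qed
  show ?thesis
  proof (intro exI[of _ x] exI[of _ "\<lambda>i. \<tau> (Gen i)"] conjI allI impI)
    have x: "FObj A x = B" "D.cocone_over (Ide G B) x \<tau>"
      using colim by (simp_all add: D.surcolimit_iff)
    then show "x \<in> Obj E" "FObj A x = B"
      "\<forall>i\<in>I. \<tau> (Gen i) \<in> Hom E (P i) x \<and> FArr A (\<tau> (Gen i)) = Ide G B"
      "\<forall>r\<in>R. \<tau> (Gen (s r)) \<cdot>\<^bsub>E\<^esub> u r = \<tau> (Gen (t r)) \<cdot>\<^bsub>E\<^esub> v r"
      unfolding cocone by simp_all
    have \<tau>: "\<tau> (Gen i) \<in> Arr E" "Dom E (\<tau> (Gen i)) = P i" "Cod E (\<tau> (Gen i)) = x" if "i \<in> I" for i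
      using x(2) that unfolding cocone by simp_all
    fix b y q
    assume q: "y \<in> Obj E \<and> b \<in> Hom G B (FObj A y) \<and>
      (\<forall>i\<in>I. q i \<in> Hom E (P i) y \<and> FArr A (q i) = b) \<and>
      (\<forall>r\<in>R. q (s r) \<cdot>\<^bsub>E\<^esub> u r = q (t r) \<cdot>\<^bsub>E\<^esub> v r)"
    \<comment> \<open>At a relation either composite would do; they agree by assumption.\<close>
    let ?\<sigma> = "\<lambda>a. case a of Gen i \<Rightarrow> q i | Rel r \<Rightarrow> q (s r) \<cdot>\<^bsub>E\<^esub> u r"
    have \<sigma>: "D.cocone_over b y ?\<sigma>"
      using q unfolding cocone by simp
    have "(\<forall>a\<in>Obj ?J. f \<cdot>\<^bsub>E\<^esub> \<tau> a = ?\<sigma> a) \<longleftrightarrow> (\<forall>i\<in>I. f \<cdot>\<^bsub>E\<^esub> \<tau> (Gen i) = q i)"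
      if f: "f \<in> Hom E x y" for f
    proof
      assume *: "\<forall>i\<in>I. f \<cdot>\<^bsub>E\<^esub> \<tau> (Gen i) = q i"
      have "f \<cdot>\<^bsub>E\<^esub> \<tau> (Rel r) = q (s r) \<cdot>\<^bsub>E\<^esub> u r" if "r \<in> R" for r
      proof -
        have "f \<cdot>\<^bsub>E\<^esub> \<tau> (Rel r) = f \<cdot>\<^bsub>E\<^esub> (\<tau> (Gen (s r)) \<cdot>\<^bsub>E\<^esub> u r)"
          using x(2) that unfolding cocone by simp
        also have "\<dots> = (f \<cdot>\<^bsub>E\<^esub> \<tau> (Gen (s r))) \<cdot>\<^bsub>E\<^esub> u r"
          using f that by (simp add: \<tau>)
        also have "\<dots> = q (s r) \<cdot>\<^bsub>E\<^esub> u r"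
          using * that ends by metis
        finally show ?thesis .
      qed
      then show "\<forall>a\<in>Obj ?J. f \<cdot>\<^bsub>E\<^esub> \<tau> a = ?\<sigma> a"
        using * by (auto simp: span_cat_def)
    qed (auto simp: span_cat_def)
    then have same: "f \<in> Hom E x y \<and> FArr A f = b \<and> (\<forall>a\<in>Obj ?J. f \<cdot>\<^bsub>E\<^esub> \<tau> a = ?\<sigma> a) \<longleftrightarrow>
        f \<in> Hom E x y \<and> FArr A f = b \<and> (\<forall>i\<in>I. f \<cdot>\<^bsub>E\<^esub> \<tau> (Gen i) = q i)" for f
      by blast
    have "\<exists>!f. f \<in> Hom E x y \<and> FArr A f = b \<and> (\<forall>a\<in>Obj ?J. f \<cdot>\<^bsub>E\<^esub> \<tau> a = ?\<sigma> a)"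
      using colim \<sigma> unfolding D.surcolimit_iff by blast
    then show "\<exists>!f. f \<in> Hom E x y \<and> FArr A f = b \<and> (\<forall>i\<in>I. f \<cdot>\<^bsub>E\<^esub> \<tau> (Gen i) = q i)"
      unfolding same .
  qed
qed

end

section \<open>The chain of partial actions\<close>

context algebra_diagram
begin

text \<open>The stage at \<open>\<beta>\<close> is a triple \<open>S \<beta> = (x\<^sub>\<beta>, c\<^sub>\<beta>, a\<^sub>\<beta>)\<close>: an object, a cocone from the underlying
  objects \<open>X j\<close>, and for each \<open>\<gamma> < \<beta>\<close> an action \<open>a\<^sub>\<beta> \<gamma> : T x\<^sub>\<gamma> \<rightarrow> x\<^sub>\<beta>\<close>. Relative to the stages below
  \<open>\<alpha>\<close>, a partial action on \<open>y\<close> over \<open>b\<close> is what an algebra structure on \<open>y\<close> together with a cocone of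
  homomorphisms leaves visible at \<open>\<alpha>\<close>; the last equation is associativity of the action. The stage at
  \<open>\<alpha>\<close> is the universal partial action.\<close>

definition partial_action ::
    "('k \<times> 'k) set \<Rightarrow> ('k \<Rightarrow> 'o \<times> ('i \<Rightarrow> 'm) \<times> ('k \<Rightarrow> 'm)) \<Rightarrow> 'k
      \<Rightarrow> 'n \<Rightarrow> 'o \<Rightarrow> ('i \<Rightarrow> 'm) \<Rightarrow> ('k \<Rightarrow> 'm) \<Rightarrow> bool" where
  "partial_action R S \<alpha> b y q p \<longleftrightarrow> U.cocone_over b y q \<and>
     (\<forall>\<beta>. (\<beta>, \<alpha>) \<in> R \<longrightarrow>
        p \<beta> \<in> Hom E (FObj T (fst (S \<beta>))) y \<and> FArr A (p \<beta>) = b \<and>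
        (\<forall>j\<in>Obj J. p \<beta> \<cdot> FArr T (fst (snd (S \<beta>)) j) = q j \<cdot> h j) \<and>
        (\<forall>\<gamma>. (\<gamma>, \<beta>) \<in> R \<longrightarrow> p \<beta> \<cdot> FArr T (snd (snd (S \<beta>)) \<gamma>) = p \<gamma> \<cdot> \<mu> (fst (S \<gamma>))))"

definition is_stage ::
    "('k \<times> 'k) set \<Rightarrow> ('k \<Rightarrow> 'o \<times> ('i \<Rightarrow> 'm) \<times> ('k \<Rightarrow> 'm)) \<Rightarrow> 'k
      \<Rightarrow> 'o \<times> ('i \<Rightarrow> 'm) \<times> ('k \<Rightarrow> 'm) \<Rightarrow> bool" where
  "is_stage R S \<alpha> = (\<lambda>(x, c, a). FObj A x = B \<and> partial_action R S \<alpha> (Ide G B) x c a \<and>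
     (\<forall>b y q p. partial_action R S \<alpha> b y q p \<longrightarrow>
        (\<exists>!f. f \<in> Hom E x y \<and> FArr A f = b \<and>
          (\<forall>j\<in>Obj J. f \<cdot> c j = q j) \<and> (\<forall>\<beta>. (\<beta>, \<alpha>) \<in> R \<longrightarrow> f \<cdot> a \<beta> = p \<beta>))))"

lemma is_stage_cong:
  assumes "trans R" and eq: "\<And>\<beta>. (\<beta>, \<alpha>) \<in> R \<Longrightarrow> S \<beta> = S' \<beta>"
  shows "is_stage R S \<alpha> = is_stage R S' \<alpha>"
proof -
  have "S \<gamma> = S' \<gamma>" if "(\<gamma>, \<beta>) \<in> R" "(\<beta>, \<alpha>) \<in> R" for \<beta> \<gamma>
    using transD[OF assms(1) that] by (rule eq)
  then have "partial_action R S \<alpha> b y q p \<longleftrightarrow> partial_action R S' \<alpha> b y q p" for b y q p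
    unfolding partial_action_def using eq by simp
  then show ?thesis
    unfolding is_stage_def by simp
qed

text \<open>The generators are the \<open>X j\<close> and the \<open>T x\<^sub>\<beta>\<close> for \<open>\<beta> < \<alpha>\<close>. The relations say that the maps from
  the \<open>X j\<close> form a cocone (one for each arrow of \<open>J\<close>), that they are homomorphisms (one for each \<open>j\<close> and
  \<open>\<beta>\<close>), and that the action is associative (one for each pair \<open>\<gamma> < \<beta>\<close>).\<close>

lemma stage_exists:
  fixes R :: "('k \<times> 'k) set"
  assumes cocomplete: "surcocomplete TYPE('u) E G A" and inf: "infinite (UNIV :: 'u set)"
    and small: "|Arr J| <o |UNIV :: 'u set|" "|{\<beta>. (\<beta>, \<alpha>) \<in> R}| <o |UNIV :: 'u set|"
    and R: "trans R" and stages: "\<And>\<beta>. (\<beta>, \<alpha>) \<in> R \<Longrightarrow> is_stage R S \<beta> (S \<beta>)"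
  shows "\<exists>s. is_stage R S \<alpha> s"
proof -
  let ?below = "{\<beta>. (\<beta>, \<alpha>) \<in> R}"
  let ?x = "\<lambda>\<beta>. fst (S \<beta>)" and ?c = "\<lambda>\<beta>. fst (snd (S \<beta>))" and ?a = "\<lambda>\<gamma> \<beta>. snd (snd (S \<beta>)) \<gamma>"
  have stage: "FObj A (?x \<beta>) = B" "U.cocone_over (Ide G B) (?x \<beta>) (?c \<beta>)"
      "\<And>\<gamma>. (\<gamma>, \<beta>) \<in> R \<Longrightarrow> ?a \<gamma> \<beta> \<in> Hom E (FObj T (?x \<gamma>)) (?x \<beta>) \<and> FArr A (?a \<gamma> \<beta>) = Ide G B"
    if "(\<beta>, \<alpha>) \<in> R" for \<beta>
    using stages[OF that] by (simp_all add: is_stage_def partial_action_def split_beta)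
  note x [simp] = stage(1)
  have c [simp]: "?x \<beta> \<in> Obj E" "\<And>j. j \<in> Obj J \<Longrightarrow> ?c \<beta> j \<in> Arr E"
      "\<And>j. j \<in> Obj J \<Longrightarrow> Dom E (?c \<beta> j) = X j" "\<And>j. j \<in> Obj J \<Longrightarrow> Cod E (?c \<beta> j) = ?x \<beta>"
      "\<And>j. j \<in> Obj J \<Longrightarrow> FArr A (?c \<beta> j) = Ide G B"
    if "(\<beta>, \<alpha>) \<in> R" for \<beta>
    using stage(2)[OF that] by (simp_all add: U.cocone_over_def)
  have a [simp]: "?a \<gamma> \<beta> \<in> Arr E" "Dom E (?a \<gamma> \<beta>) = FObj T (?x \<gamma>)"
      "Cod E (?a \<gamma> \<beta>) = ?x \<beta>" "FArr A (?a \<gamma> \<beta>) = Ide G B"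
    if "(\<beta>, \<alpha>) \<in> R" "(\<gamma>, \<beta>) \<in> R" for \<beta> \<gamma>
    using stage(3)[OF that] by simp_all
  have below [simp]: "(\<gamma>, \<alpha>) \<in> R" if "(\<beta>, \<alpha>) \<in> R" "(\<gamma>, \<beta>) \<in> R" for \<beta> \<gamma>
    using transD[OF R that(2,1)] .
  define I where "I = Obj J <+> ?below"
  define P where "P = case_sum X (\<lambda>\<beta>. FObj T (?x \<beta>))"
  define Rel where "Rel = Arr J <+> (Obj J \<times> ?below <+> {(\<gamma>, \<beta>). (\<gamma>, \<beta>) \<in> R \<and> (\<beta>, \<alpha>) \<in> R})"
  define lhs :: "'j + 'i \<times> 'k + 'k \<times> 'k \<Rightarrow> 'i + 'k"
    where "lhs = case_sum (\<lambda>f. Inl (Cod J f)) (case_sum (\<lambda>(j, \<beta>). Inr \<beta>) (\<lambda>(\<gamma>, \<beta>). Inr \<beta>))"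
  define rhs :: "'j + 'i \<times> 'k + 'k \<times> 'k \<Rightarrow> 'i + 'k"
    where "rhs = case_sum (\<lambda>f. Inl (Dom J f)) (case_sum (\<lambda>(j, \<beta>). Inl j) (\<lambda>(\<gamma>, \<beta>). Inr \<gamma>))"
  define u :: "'j + 'i \<times> 'k + 'k \<times> 'k \<Rightarrow> 'm"
    where "u = case_sum d (case_sum (\<lambda>(j, \<beta>). FArr T (?c \<beta> j)) (\<lambda>(\<gamma>, \<beta>). FArr T (?a \<gamma> \<beta>)))"
  define v :: "'j + 'i \<times> 'k + 'k \<times> 'k \<Rightarrow> 'm"
    where "v = case_sum (\<lambda>f. Ide E (X (Dom J f))) (case_sum (\<lambda>(j, \<beta>). h j) (\<lambda>(\<gamma>, \<beta>). \<mu> (?x \<gamma>)))"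
  define Q :: "'j + 'i \<times> 'k + 'k \<times> 'k \<Rightarrow> 'o"
    where "Q = case_sum (\<lambda>f. X (Dom J f)) (case_sum (\<lambda>(j, \<beta>). FObj T (X j)) (\<lambda>(\<gamma>, \<beta>). FObj T (FObj T (?x \<gamma>))))"
  note defs = I_def P_def Rel_def lhs_def rhs_def u_def v_def Q_def
  have Obj_small: "|Obj J| <o |UNIV :: 'u set|"
    using J.card_Obj_ordLeq_card_Arr small(1) by (rule ordLeq_ordLess_trans)
  have "{(\<gamma>, \<beta>). (\<gamma>, \<beta>) \<in> R \<and> (\<beta>, \<alpha>) \<in> R} \<subseteq> ?below \<times> ?below"
    by auto
  then have "|{(\<gamma>, \<beta>). (\<gamma>, \<beta>) \<in> R \<and> (\<beta>, \<alpha>) \<in> R}| <o |UNIV :: 'u set|"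
    using card_of_mono1 card_of_Times_ordLess_infinite[OF inf small(2) small(2)] ordLeq_ordLess_trans
    by blast
  then have smalls: "|I| <o |UNIV :: 'u set|" "|Rel| <o |UNIV :: 'u set|"
    unfolding I_def Rel_def
    by (simp_all add: card_of_Plus_ordLess_infinite[OF inf] card_of_Times_ordLess_infinite[OF inf]
        Obj_small small)
  have I_iff: "(\<forall>i\<in>I. Z i) \<longleftrightarrow> (\<forall>j\<in>Obj J. Z (Inl j)) \<and> (\<forall>\<beta>. (\<beta>, \<alpha>) \<in> R \<longrightarrow> Z (Inr \<beta>))" for Z
    by (auto simp: I_def)
  have Rel_iff: "(\<forall>r\<in>Rel. Z r) \<longleftrightarrow> (\<forall>f\<in>Arr J. Z (Inl f)) \<and>
      (\<forall>j\<in>Obj J. \<forall>\<beta>. (\<beta>, \<alpha>) \<in> R \<longrightarrow> Z (Inr (Inl (j, \<beta>)))) \<and>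
      (\<forall>\<beta> \<gamma>. (\<beta>, \<alpha>) \<in> R \<longrightarrow> (\<gamma>, \<beta>) \<in> R \<longrightarrow> Z (Inr (Inr (\<gamma>, \<beta>))))" for Z
    by (auto simp: Rel_def)
  have presentation: "y \<in> Obj E \<and> b \<in> Hom G B (FObj A y) \<and>
       (\<forall>i\<in>I. q i \<in> Hom E (P i) y \<and> FArr A (q i) = b) \<and>
       (\<forall>r\<in>Rel. q (lhs r) \<cdot> u r = q (rhs r) \<cdot> v r) \<longleftrightarrow>
      partial_action R S \<alpha> b y (\<lambda>j. q (Inl j)) (\<lambda>\<beta>. q (Inr \<beta>))" for b y q
  proof (cases "\<forall>j\<in>Obj J. q (Inl j) \<in> Hom E (X j) y")
    case True
    then have "q (Inl (Dom J f)) \<cdot> Ide E (X (Dom J f)) = q (Inl (Dom J f))" if "f \<in> Arr J" for f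
      using that by simp
    then show ?thesis
      unfolding I_iff Rel_iff partial_action_def U.cocone_over_def
      by (simp add: P_def lhs_def rhs_def u_def v_def) blast
  next
    case False
    then show ?thesis
      unfolding I_iff partial_action_def U.cocone_over_def by (simp add: P_def) blast
  qed
  have "\<exists>x p. x \<in> Obj E \<and> FObj A x = B \<and>
    (\<forall>i\<in>I. p i \<in> Hom E (P i) x \<and> FArr A (p i) = Ide G B) \<and>
    (\<forall>r\<in>Rel. p (lhs r) \<cdot> u r = p (rhs r) \<cdot> v r) \<and>
    (\<forall>b y q. y \<in> Obj E \<and> b \<in> Hom G B (FObj A y) \<and>
       (\<forall>i\<in>I. q i \<in> Hom E (P i) y \<and> FArr A (q i) = b) \<and>
       (\<forall>r\<in>Rel. q (lhs r) \<cdot> u r = q (rhs r) \<cdot> v r) \<longrightarrow>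
       (\<exists>!f. f \<in> Hom E x y \<and> FArr A f = b \<and> (\<forall>i\<in>I. f \<cdot> p i = q i)))"
    by (rule generators_and_relations[OF cocomplete inf smalls, where Q = Q])
      (auto simp: defs)
  then obtain x p where Ax: "FObj A x = B"
    and p: "x \<in> Obj E \<and> Ide G B \<in> Hom G B (FObj A x) \<and>
       (\<forall>i\<in>I. p i \<in> Hom E (P i) x \<and> FArr A (p i) = Ide G B) \<and>
       (\<forall>r\<in>Rel. p (lhs r) \<cdot> u r = p (rhs r) \<cdot> v r)"
    and univ: "\<And>b y q. y \<in> Obj E \<and> b \<in> Hom G B (FObj A y) \<and>
       (\<forall>i\<in>I. q i \<in> Hom E (P i) y \<and> FArr A (q i) = b) \<and>
       (\<forall>r\<in>Rel. q (lhs r) \<cdot> u r = q (rhs r) \<cdot> v r) \<Longrightarrow>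
       \<exists>!f. f \<in> Hom E x y \<and> FArr A f = b \<and> (\<forall>i\<in>I. f \<cdot> p i = q i)"
    by auto
  have "is_stage R S \<alpha> (x, \<lambda>j. p (Inl j), \<lambda>\<beta>. p (Inr \<beta>))"
    unfolding is_stage_def prod.case
  proof (intro conjI allI impI)
    show "partial_action R S \<alpha> (Ide G B) x (\<lambda>j. p (Inl j)) (\<lambda>\<beta>. p (Inr \<beta>))"
      using p unfolding presentation .
  next
    fix b y q p'
    assume "partial_action R S \<alpha> b y q p'"
    then show "\<exists>!f. f \<in> Hom E x y \<and> FArr A f = b \<and> (\<forall>j\<in>Obj J. f \<cdot> p (Inl j) = q j) \<and>
        (\<forall>\<beta>. (\<beta>, \<alpha>) \<in> R \<longrightarrow> f \<cdot> p (Inr \<beta>) = p' \<beta>)"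
      using univ[unfolded presentation, of b y "case_sum q p'"] by (simp add: I_iff)
  qed (rule Ax)
  then show ?thesis by blast
qed

end

text \<open>A chain of universal partial actions along a well-founded transitive relation; \<open>a \<beta> \<alpha>\<close> is the
  action \<open>T (x \<beta>) \<rightarrow> x \<alpha>\<close>, meaningful for \<open>(\<beta>, \<alpha>) \<in> R\<close>.\<close>

locale action_chain = algebra_diagram E G A T \<eta> \<mu> J D B
  for E :: "('o, 'm) cat" (structure) and G :: "('p, 'n) cat" and A :: "('o, 'm, 'p, 'n) func"
    and T \<eta> \<mu> and J :: "('i, 'j) cat" and D B +
  fixes R :: "('k \<times> 'k) set" and S :: "'k \<Rightarrow> 'o \<times> ('i \<Rightarrow> 'm) \<times> ('k \<Rightarrow> 'm)"
  assumes wf: "wf R" and trans: "trans R" and stage: "is_stage R S \<alpha> (S \<alpha>)"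
begin

abbreviation "x \<alpha> \<equiv> fst (S \<alpha>)"
abbreviation "c \<alpha> j \<equiv> fst (snd (S \<alpha>)) j"
abbreviation "a \<beta> \<alpha> \<equiv> snd (snd (S \<alpha>)) \<beta>"

definition link :: "'k \<Rightarrow> 'k \<Rightarrow> 'm" where
  "link \<beta> \<alpha> = (if \<beta> = \<alpha> then Ide E (x \<alpha>) else a \<beta> \<alpha> \<cdot> \<eta> (x \<beta>))"

lemma less_less [trans]: "(\<gamma>, \<beta>) \<in> R \<Longrightarrow> (\<beta>, \<alpha>) \<in> R \<Longrightarrow> (\<gamma>, \<alpha>) \<in> R"
  using trans by (rule transD)

lemma not_less_self [simp]: "(\<alpha>, \<alpha>) \<notin> R"
  using wf by (rule wf_not_refl)

lemma stage_universal:
  assumes "partial_action R S \<alpha> b y q p"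
  shows "\<exists>!f. f \<in> Hom E (x \<alpha>) y \<and> FArr A f = b \<and>
    (\<forall>j\<in>Obj J. f \<cdot> c \<alpha> j = q j) \<and> (\<forall>\<beta>. (\<beta>, \<alpha>) \<in> R \<longrightarrow> f \<cdot> a \<beta> \<alpha> = p \<beta>)"
  using stage[of \<alpha>] assms unfolding is_stage_def split_beta by blast

lemma stage_action:
  "FObj A (x \<alpha>) = B" "partial_action R S \<alpha> (Ide G B) (x \<alpha>) (c \<alpha>) (\<lambda>\<beta>. a \<beta> \<alpha>)"
  using stage[of \<alpha>] unfolding is_stage_def split_beta by blast+

lemma x_typing [simp]: "x \<alpha> \<in> Obj E" "FObj A (x \<alpha>) = B"
  using stage_action[of \<alpha>] by (simp_all add: partial_action_def U.cocone_over_def)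

lemma c_typing [simp]:
  assumes "j \<in> Obj J"
  shows "c \<alpha> j \<in> Arr E" "Dom E (c \<alpha> j) = X j" "Cod E (c \<alpha> j) = x \<alpha>" "FArr A (c \<alpha> j) = Ide G B"
  using stage_action(2)[of \<alpha>] assms by (simp_all add: partial_action_def U.cocone_over_def)

lemma c_cocone: "f \<in> Arr J \<Longrightarrow> c \<alpha> (Cod J f) \<cdot> d f = c \<alpha> (Dom J f)"
  using stage_action[of \<alpha>] by (simp_all add: partial_action_def U.cocone_over_def)

lemma a_typing [simp]:
  assumes "(\<beta>, \<alpha>) \<in> R"
  shows "a \<beta> \<alpha> \<in> Arr E" "Dom E (a \<beta> \<alpha>) = FObj T (x \<beta>)" "Cod E (a \<beta> \<alpha>) = x \<alpha>"
    "FArr A (a \<beta> \<alpha>) = Ide G B"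
  using stage_action(2)[of \<alpha>] assms by (simp_all add: partial_action_def)

lemma a_c: "(\<beta>, \<alpha>) \<in> R \<Longrightarrow> j \<in> Obj J \<Longrightarrow> a \<beta> \<alpha> \<cdot> FArr T (c \<beta> j) = c \<alpha> j \<cdot> h j"
  using stage_action(2)[of \<alpha>] by (simp add: partial_action_def)

lemma a_assoc: "(\<gamma>, \<beta>) \<in> R \<Longrightarrow> (\<beta>, \<alpha>) \<in> R \<Longrightarrow> a \<beta> \<alpha> \<cdot> FArr T (a \<gamma> \<beta>) = a \<gamma> \<alpha> \<cdot> \<mu> (x \<gamma>)"
  using stage_action(2)[of \<alpha>] by (simp add: partial_action_def)

lemma link_typing [simp]:
  assumes "\<beta> = \<alpha> \<or> (\<beta>, \<alpha>) \<in> R"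
  shows "link \<beta> \<alpha> \<in> Arr E" "Dom E (link \<beta> \<alpha>) = x \<beta>" "Cod E (link \<beta> \<alpha>) = x \<alpha>"
    "FArr A (link \<beta> \<alpha>) = Ide G B"
  using assms by (auto simp: link_def)

text \<open>Naturality of the unit turns \<open>a \<beta> \<alpha> \<cdot> \<eta> \<cdot> a \<gamma> \<beta>\<close> into \<open>a \<beta> \<alpha> \<cdot> T (a \<gamma> \<beta>) \<cdot> \<eta>\<close>; partial
  associativity and the left unit law do the rest. Functoriality of the links is a consequence.\<close>

lemma link_a:
  assumes "(\<gamma>, \<beta>) \<in> R" "\<beta> = \<alpha> \<or> (\<beta>, \<alpha>) \<in> R"
  shows "link \<beta> \<alpha> \<cdot> a \<gamma> \<beta> = a \<gamma> \<alpha>"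
proof (cases "\<beta> = \<alpha>")
  case True
  then show ?thesis using assms by (simp add: link_def)
next
  case False
  then have \<beta>\<alpha>: "(\<beta>, \<alpha>) \<in> R" and \<gamma>\<alpha>: "(\<gamma>, \<alpha>) \<in> R"
    using assms less_less by blast+
  have "link \<beta> \<alpha> \<cdot> a \<gamma> \<beta> = a \<beta> \<alpha> \<cdot> (\<eta> (x \<beta>) \<cdot> a \<gamma> \<beta>)"
    using False \<beta>\<alpha> assms(1) by (simp add: link_def)
  also have "\<dots> = (a \<beta> \<alpha> \<cdot> FArr T (a \<gamma> \<beta>)) \<cdot> \<eta> (FObj T (x \<gamma>))"
    using \<beta>\<alpha> assms(1) by (simp add: unit_natural[of "a \<gamma> \<beta>" "FObj T (x \<gamma>)"])
  also have "\<dots> = a \<gamma> \<alpha> \<cdot> (\<mu> (x \<gamma>) \<cdot> \<eta> (FObj T (x \<gamma>)))"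
    using \<gamma>\<alpha> by (simp add: a_assoc[OF assms(1) \<beta>\<alpha>])
  also have "\<dots> = a \<gamma> \<alpha>"
    using \<gamma>\<alpha> by (simp add: unit_left)
  finally show ?thesis .
qed

lemma link_link:
  assumes "\<gamma> = \<beta> \<or> (\<gamma>, \<beta>) \<in> R" "\<beta> = \<alpha> \<or> (\<beta>, \<alpha>) \<in> R"
  shows "link \<beta> \<alpha> \<cdot> link \<gamma> \<beta> = link \<gamma> \<alpha>"
proof (cases "\<gamma> = \<beta>")
  case True
  then show ?thesis using assms(2) by (simp add: link_def[of \<beta> \<beta>])
next
  case False
  then have \<gamma>\<beta>: "(\<gamma>, \<beta>) \<in> R" and \<gamma>\<alpha>: "(\<gamma>, \<alpha>) \<in> R"
    using assms less_less by blast+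
  then have "\<gamma> \<noteq> \<alpha>" by auto
  have "link \<beta> \<alpha> \<cdot> link \<gamma> \<beta> = (link \<beta> \<alpha> \<cdot> a \<gamma> \<beta>) \<cdot> \<eta> (x \<gamma>)"
    using False \<gamma>\<beta> assms(2) by (simp add: link_def[of \<gamma> \<beta>])
  also have "\<dots> = link \<gamma> \<alpha>"
    using \<open>\<gamma> \<noteq> \<alpha>\<close> by (simp only: link_a[OF \<gamma>\<beta> assms(2)]) (simp add: link_def)
  finally show ?thesis .
qed

lemma link_c:
  assumes "\<beta> = \<alpha> \<or> (\<beta>, \<alpha>) \<in> R" and j: "j \<in> Obj J"
  shows "link \<beta> \<alpha> \<cdot> c \<beta> j = c \<alpha> j"
proof (cases "\<beta> = \<alpha>")
  case True
  then show ?thesis using j by (simp add: link_def)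
next
  case False
  then have \<beta>\<alpha>: "(\<beta>, \<alpha>) \<in> R" using assms by blast
  have "link \<beta> \<alpha> \<cdot> c \<beta> j = (a \<beta> \<alpha> \<cdot> FArr T (c \<beta> j)) \<cdot> \<eta> (X j)"
    using False \<beta>\<alpha> j by (simp add: link_def unit_natural[of "c \<beta> j" "X j"])
  also have "\<dots> = c \<alpha> j \<cdot> (h j \<cdot> \<eta> (X j))"
    using j by (simp add: a_c[OF \<beta>\<alpha> j])
  also have "\<dots> = c \<alpha> j"
    using j by (simp add: structure_laws)
  finally show ?thesis .
qed

text \<open>The counterpart of \<open>link_a\<close>, from partial associativity and the right unit law: the actions
  with a fixed target \<open>x \<alpha>\<close> form a cocone on the image of the chain under \<open>T\<close>.\<close>

lemma a_T_link:
  assumes "\<gamma> = \<beta> \<or> (\<gamma>, \<beta>) \<in> R" "(\<beta>, \<alpha>) \<in> R"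
  shows "a \<beta> \<alpha> \<cdot> FArr T (link \<gamma> \<beta>) = a \<gamma> \<alpha>"
proof (cases "\<gamma> = \<beta>")
  case True
  then show ?thesis using assms(2) by (simp add: link_def[of \<beta> \<beta>])
next
  case False
  then have \<gamma>\<beta>: "(\<gamma>, \<beta>) \<in> R" and \<gamma>\<alpha>: "(\<gamma>, \<alpha>) \<in> R"
    using assms less_less by blast+
  have "a \<beta> \<alpha> \<cdot> FArr T (link \<gamma> \<beta>) = (a \<beta> \<alpha> \<cdot> FArr T (a \<gamma> \<beta>)) \<cdot> FArr T (\<eta> (x \<gamma>))"
    using False \<gamma>\<beta> assms(2) by (simp add: link_def T_Cmp)
  also have "\<dots> = a \<gamma> \<alpha> \<cdot> (\<mu> (x \<gamma>) \<cdot> FArr T (\<eta> (x \<gamma>)))"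
    using \<gamma>\<alpha> by (simp add: a_assoc[OF \<gamma>\<beta> assms(2)])
  also have "\<dots> = a \<gamma> \<alpha>"
    using \<gamma>\<alpha> by (simp add: unit_right)
  finally show ?thesis .
qed

text \<open>Here \<open>s\<close> is a cocone into an algebra \<open>y\<close>, and \<open>f\<close> extends it to stage \<open>\<alpha>\<close> compatibly with the
  actions, when the extension to each lower stage \<open>\<beta>\<close> is \<open>g \<beta>\<close>.\<close>

definition is_extension :: "'n \<Rightarrow> 'o \<times> 'm \<Rightarrow> ('i \<Rightarrow> 'm) \<Rightarrow> ('k \<Rightarrow> 'm) \<Rightarrow> 'k \<Rightarrow> 'm \<Rightarrow> bool" where
  "is_extension b y s g \<alpha> f \<longleftrightarrow> f \<in> Hom E (x \<alpha>) (fst y) \<and> FArr A f = b \<and>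
     (\<forall>j\<in>Obj J. f \<cdot> c \<alpha> j = s j) \<and> (\<forall>\<beta>. (\<beta>, \<alpha>) \<in> R \<longrightarrow> f \<cdot> a \<beta> \<alpha> = snd y \<cdot> FArr T (g \<beta>))"

text \<open>The maps \<open>k \<cdot> T (g \<beta>)\<close>, where \<open>k\<close> is the structure map of \<open>y\<close>, form a partial action on \<open>y\<close>
  by associativity of \<open>k\<close>, so the universal property of the stage applies.\<close>

lemma extension_step:
  assumes y: "is_algebra E T \<eta> \<mu> y" and s: "U.cocone_over b (fst y) s"
    and hom: "\<And>j. j \<in> Obj J \<Longrightarrow> s j \<cdot> h j = snd y \<cdot> FArr T (s j)"
    and g: "\<And>\<beta>. (\<beta>, \<alpha>) \<in> R \<Longrightarrow> is_extension b y s g \<beta> (g \<beta>)"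
  shows "\<exists>!f. is_extension b y s g \<alpha> f"
proof -
  note [simp] = algebraD(1-4)[OF y] algebra_arity[OF y]
  have b [simp]: "b \<in> Arr G" "Dom G b = B" "Cod G b = FObj A (fst y)"
    using s by (simp_all add: U.cocone_over_def)
  have g_typing [simp]: "g \<beta> \<in> Arr E" "Dom E (g \<beta>) = x \<beta>" "Cod E (g \<beta>) = fst y" "FArr A (g \<beta>) = b"
    if "(\<beta>, \<alpha>) \<in> R" for \<beta>
    using g[OF that] by (simp_all add: is_extension_def)
  have "partial_action R S \<alpha> b (fst y) s (\<lambda>\<beta>. snd y \<cdot> FArr T (g \<beta>))"
    unfolding partial_action_def
  proof (intro conjI allI impI ballI s)
    fix \<beta> assume \<beta>: "(\<beta>, \<alpha>) \<in> R"
    then show "snd y \<cdot> FArr T (g \<beta>) \<in> Hom E (FObj T (x \<beta>)) (fst y)"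
      "FArr A (snd y \<cdot> FArr T (g \<beta>)) = b"
      by simp_all
  next
    fix \<beta> j assume \<beta>: "(\<beta>, \<alpha>) \<in> R" and j: "j \<in> Obj J"
    have "(snd y \<cdot> FArr T (g \<beta>)) \<cdot> FArr T (c \<beta> j) = snd y \<cdot> FArr T (g \<beta> \<cdot> c \<beta> j)"
      using \<beta> j by (simp add: T_Cmp)
    also have "\<dots> = s j \<cdot> h j"
      using g[OF \<beta>] j by (simp add: is_extension_def hom)
    finally show "(snd y \<cdot> FArr T (g \<beta>)) \<cdot> FArr T (c \<beta> j) = s j \<cdot> h j" .
  next
    fix \<beta> \<gamma> assume \<beta>: "(\<beta>, \<alpha>) \<in> R" and \<gamma>: "(\<gamma>, \<beta>) \<in> R"
    then have \<gamma>\<alpha>: "(\<gamma>, \<alpha>) \<in> R" by (blast intro: less_less)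
    have "(snd y \<cdot> FArr T (g \<beta>)) \<cdot> FArr T (a \<gamma> \<beta>) = snd y \<cdot> FArr T (g \<beta> \<cdot> a \<gamma> \<beta>)"
      using \<beta> \<gamma> by (simp add: T_Cmp)
    also have "\<dots> = snd y \<cdot> FArr T (snd y \<cdot> FArr T (g \<gamma>))"
      using g[OF \<beta>] \<gamma> by (simp add: is_extension_def)
    also have "\<dots> = (snd y \<cdot> FArr T (snd y)) \<cdot> FArr T (FArr T (g \<gamma>))"
      using \<gamma>\<alpha> by (simp add: T_Cmp)
    also have "\<dots> = snd y \<cdot> (\<mu> (fst y) \<cdot> FArr T (FArr T (g \<gamma>)))"
      using \<gamma>\<alpha> by (simp add: algebraD(6)[OF y, symmetric])
    also have "\<dots> = (snd y \<cdot> FArr T (g \<gamma>)) \<cdot> \<mu> (x \<gamma>)"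
      using \<gamma>\<alpha> by (simp add: mult_natural[of "g \<gamma>" "x \<gamma>"])
    finally show "(snd y \<cdot> FArr T (g \<beta>)) \<cdot> FArr T (a \<gamma> \<beta>) = (snd y \<cdot> FArr T (g \<gamma>)) \<cdot> \<mu> (x \<gamma>)" .
  qed
  then show ?thesis
    unfolding is_extension_def by (rule stage_universal)
qed

lemma extension_exists:
  assumes "is_algebra E T \<eta> \<mu> y" and "U.cocone_over b (fst y) s"
    and "\<And>j. j \<in> Obj J \<Longrightarrow> s j \<cdot> h j = snd y \<cdot> FArr T (s j)"
  shows "\<exists>g. \<forall>\<alpha>. is_extension b y s g \<alpha> (g \<alpha>)"
proof (rule dependent_wf_choice[OF wf])
  show "is_extension b y s f \<alpha> r = is_extension b y s g \<alpha> r"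
    if "\<And>z. (z, \<alpha>) \<in> R \<Longrightarrow> f z = g z" for f g \<alpha> r
    using that by (simp add: is_extension_def)
  show "\<exists>r. is_extension b y s f \<alpha> r"
    if "\<And>z. (z, \<alpha>) \<in> R \<Longrightarrow> is_extension b y s f z (f z)" for f \<alpha>
    using extension_step[OF assms that] by blast
qed

lemma extension_unique:
  assumes "is_algebra E T \<eta> \<mu> y" and "U.cocone_over b (fst y) s"
    and "\<And>j. j \<in> Obj J \<Longrightarrow> s j \<cdot> h j = snd y \<cdot> FArr T (s j)"
    and f: "\<And>\<alpha>. is_extension b y s f \<alpha> (f \<alpha>)" and g: "\<And>\<alpha>. is_extension b y s g \<alpha> (g \<alpha>)"
  shows "f \<alpha> = g \<alpha>"
proof (induction \<alpha> rule: wf_induct_rule[OF wf])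
  case (1 \<alpha>)
  then have "is_extension b y s f \<alpha> (g \<alpha>)"
    using g[of \<alpha>] by (simp add: is_extension_def)
  then show ?case
    using extension_step[OF assms(1-3) f, of \<alpha>] f[of \<alpha>] by blast
qed

lemma extension_link:
  assumes y: "is_algebra E T \<eta> \<mu> y" and g: "\<And>\<alpha>. is_extension b y s g \<alpha> (g \<alpha>)"
    and \<beta>: "\<beta> = \<alpha> \<or> (\<beta>, \<alpha>) \<in> R"
  shows "g \<alpha> \<cdot> link \<beta> \<alpha> = g \<beta>"
proof (cases "\<beta> = \<alpha>")
  case True
  then show ?thesis using g[of \<alpha>] by (simp add: link_def is_extension_def)
next
  case False
  then have \<beta>\<alpha>: "(\<beta>, \<alpha>) \<in> R" using \<beta> by blast
  note [simp] = algebraD(1-4)[OF y]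
  have g_typing [simp]: "g \<beta> \<in> Arr E" "Dom E (g \<beta>) = x \<beta>" "Cod E (g \<beta>) = fst y" for \<beta>
    using g[of \<beta>] by (simp_all add: is_extension_def)
  have "g \<alpha> \<cdot> link \<beta> \<alpha> = (g \<alpha> \<cdot> a \<beta> \<alpha>) \<cdot> \<eta> (x \<beta>)"
    using False \<beta>\<alpha> by (simp add: link_def)
  also have "\<dots> = (snd y \<cdot> FArr T (g \<beta>)) \<cdot> \<eta> (x \<beta>)"
    using g[of \<alpha>] \<beta>\<alpha> unfolding is_extension_def by metis
  also have "\<dots> = (snd y \<cdot> \<eta> (fst y)) \<cdot> g \<beta>"
    by (simp add: unit_natural[of "g \<beta>" "x \<beta>"])
  also have "\<dots> = g \<beta>"
    by (simp add: algebraD(5)[OF y])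
  finally show ?thesis .
qed

end

section \<open>Regular cardinals as filtered categories\<close>

text \<open>The arrow \<open>a \<rightarrow> b\<close> is coded as \<open>e (a, b)\<close>. The injection \<open>e\<close> brings objects and arrows into the
  same type, as the notions of small and of filtered category demand.\<close>

definition order_cat :: "'a rel \<Rightarrow> ('a \<times> 'a \<Rightarrow> 'b) \<Rightarrow> ('a, 'b) cat" where
  "order_cat r e =
    \<lparr>Obj = Field r, Arr = e ` r, Dom = (\<lambda>u. fst (inv e u)), Cod = (\<lambda>u. snd (inv e u)),
     Ide = (\<lambda>a. e (a, a)), Cmp = (\<lambda>v u. e (fst (inv e u), snd (inv e v)))\<rparr>"

lemma order_cat_simps [simp]:
  "Obj (order_cat r e) = Field r" "Arr (order_cat r e) = e ` r"
  "inj e \<Longrightarrow> Dom (order_cat r e) (e p) = fst p" "inj e \<Longrightarrow> Cod (order_cat r e) (e p) = snd p"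
  "Ide (order_cat r e) a = e (a, a)"
  "inj e \<Longrightarrow> e q \<cdot>\<^bsub>order_cat r e\<^esub> e p = e (fst p, snd q)"
  by (simp_all add: order_cat_def)

lemma category_order_cat:
  assumes e [simp]: "inj e" and r: "\<And>a. a \<in> Field r \<Longrightarrow> (a, a) \<in> r" "trans r"
  shows "category (order_cat r e)"
  by unfold_locales (auto simp: FieldI1 FieldI2 r(1) dest: transD[OF r(2)])

lemma Card_order_props:
  assumes "Cinfinite \<kappa>"
  shows "\<And>a. a \<in> Field \<kappa> \<Longrightarrow> (a, a) \<in> \<kappa>" "trans \<kappa>" "antisym \<kappa>"
    "\<And>a b. a \<in> Field \<kappa> \<Longrightarrow> b \<in> Field \<kappa> \<Longrightarrow> (a, b) \<in> \<kappa> \<or> (b, a) \<in> \<kappa>" "wf (\<kappa> - Id)"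
    "\<And>a. a \<in> Field \<kappa> \<Longrightarrow> \<exists>b. (a, b) \<in> \<kappa> - Id"
proof -
  have well: "Well_order \<kappa>"
    using assms by (auto simp: card_order_on_def)
  then show refl: "(a, a) \<in> \<kappa>" if "a \<in> Field \<kappa>" for a
    using that by (auto simp: order_on_defs refl_on_def)
  show "trans \<kappa>" "antisym \<kappa>" "wf (\<kappa> - Id)"
    using well by (auto simp: order_on_defs)
  show "(a, b) \<in> \<kappa> \<or> (b, a) \<in> \<kappa>" if "a \<in> Field \<kappa>" "b \<in> Field \<kappa>" for a b
    using well refl that by (cases "a = b") (auto simp: order_on_defs total_on_def)
  show "\<exists>b. (a, b) \<in> \<kappa> - Id" if "a \<in> Field \<kappa>" for a
    using infinite_Card_order_limit[of \<kappa> a] assms that by (auto simp: cinfinite_def)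
qed

text \<open>A diagram with fewer than \<open>\<kappa>\<close> arrows has fewer than \<open>\<kappa>\<close> objects, so by regularity they are not
  cofinal; an upper bound is a cocone.\<close>

lemma filtered_order_cat:
  assumes \<kappa>: "Cinfinite \<kappa>" and regular: "regularCard \<kappa>" and e [simp]: "inj e"
  shows "filtered_category \<kappa> (order_cat \<kappa> e)"
  unfolding filtered_category_def
proof (intro conjI allI impI)
  note order = Card_order_props[OF \<kappa>]
  show cat: "category (order_cat \<kappa> e)"
    using order(1,2) by (intro category_order_cat) simp_all
  fix K F
  assume "category K \<and> |Arr K| <o \<kappa> \<and> is_functor K (order_cat \<kappa> e) F"
  then have K: "category K" and small: "|Arr K| <o \<kappa>" and F: "is_functor K (order_cat \<kappa> e) F"
    by blast+
  interpret K: category K by fact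
  have Fob [simp]: "FObj F k \<in> Field \<kappa>" if "k \<in> Obj K" for k
    using F that by (simp add: is_functor_iff[OF K])
  have "|FObj F ` Obj K| \<le>o |Arr K|"
    using card_of_image K.card_Obj_ordLeq_card_Arr by (rule ordLeq_transitive)
  then have "|FObj F ` Obj K| <o \<kappa>"
    using small by (rule ordLeq_ordLess_trans)
  then have "\<not> |FObj F ` Obj K| =o \<kappa>"
    by (rule not_ordLess_ordIso)
  then have "\<not> cofinal (FObj F ` Obj K) \<kappa>"
    using regular Fob unfolding regularCard_def by blast
  then obtain b where b: "b \<in> Field \<kappa>" "\<And>k. k \<in> Obj K \<Longrightarrow> \<not> (b \<noteq> FObj F k \<and> (b, FObj F k) \<in> \<kappa>)"
    unfolding cofinal_def by blast
  have le: "(FObj F k, b) \<in> \<kappa>" if "k \<in> Obj K" for k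
    using b(2)[OF that] order(4)[OF b(1) Fob[OF that]] order(1)[OF b(1)] by auto
  have "is_cocone K (order_cat \<kappa> e) F b (\<lambda>k. e (FObj F k, b))"
    unfolding is_cocone_iff[OF K cat]
  proof (intro conjI ballI)
    fix f assume f: "f \<in> Arr K"
    then obtain p where p: "FArr F f = e p" "p \<in> \<kappa>" "fst p = FObj F (Dom K f)"
      using F by (auto simp: is_functor_iff[OF K])
    then show "e (FObj F (Cod K f), b) \<cdot>\<^bsub>order_cat \<kappa> e\<^esub> FArr F f = e (FObj F (Dom K f), b)"
      by simp
  qed (use le b in auto)
  then show "\<exists>x \<sigma>. is_cocone K (order_cat \<kappa> e) F x \<sigma>" by blast
qed

section \<open>The algebra at the end of the chain\<close>

lemma (in surmonad) surdiagram_T: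
  assumes J: "category J" and D: "surdiagram E G A J D B"
  shows "surdiagram E G A J (T \<circ>\<^sub>F D) B"
proof -
  interpret D: diagram_over E G A J D B
    using J D surcategory_axioms by (simp add: diagram_over_def diagram_over_axioms_def)
  have "is_functor J E D"
    using D by (simp add: surdiagram_iff)
  then show ?thesis
    unfolding surdiagram_iff is_functor_iff[OF J] by (auto simp: comp_func_def T_Cmp)
qed

locale cardinal_action_chain = action_chain E G A T \<eta> \<mu> J D B "\<kappa> - Id" S
  for E :: "('o, 'm) cat" (structure) and G :: "('p, 'n) cat" and A :: "('o, 'm, 'p, 'n) func"
    and T \<eta> \<mu> and J :: "('i, 'j) cat" and D B and \<kappa> :: "'u rel" and S +
  fixes e :: "'u \<times> 'u \<Rightarrow> 'u"
  assumes \<kappa>: "Cinfinite \<kappa>" and e [simp]: "inj e"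
begin

lemmas order = Card_order_props[OF \<kappa>]

abbreviation "K \<equiv> order_cat \<kappa> e"

definition chain :: "('u, 'u, 'o, 'm) func" where
  "chain = \<lparr>FObj = x, FArr = (\<lambda>u. link (fst (inv e u)) (snd (inv e u)))\<rparr>"

lemma chain_simps [simp]: "FObj chain \<alpha> = x \<alpha>" "FArr chain (e (\<beta>, \<alpha>)) = link \<beta> \<alpha>"
  by (simp_all add: chain_def)

lemma category_K: "category K"
  using order(1,2) by (intro category_order_cat) simp_all

lemma surdiagram_chain: "surdiagram E G A K chain B"
proof -
  have "link \<alpha> \<alpha> = Ide E (x \<alpha>)" for \<alpha>
    by (simp add: link_def)
  then have "is_functor K E chain"
    unfolding is_functor_iff[OF category_K] by (auto intro!: link_link[symmetric])
  then show ?thesis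
    by (auto simp: surdiagram_iff)
qed

sublocale L: diagram_over E G A K chain B
  using surdiagram_chain category_K surcategory_axioms
  by (simp add: diagram_over_def diagram_over_axioms_def)

sublocale LT: diagram_over E G A K "T \<circ>\<^sub>F chain" B
  using surdiagram_T[OF category_K surdiagram_chain] category_K surcategory_axioms
  by (simp add: diagram_over_def diagram_over_axioms_def)

sublocale LTT: diagram_over E G A K "T \<circ>\<^sub>F T \<circ>\<^sub>F chain" B
  using surdiagram_T[OF category_K LT.surdiagram] category_K surcategory_axioms
  by (simp add: diagram_over_def diagram_over_axioms_def)

lemma L_cocone_iff:
  "L.cocone_over b y \<sigma> \<longleftrightarrow> y \<in> Obj E \<and> b \<in> Hom G B (FObj A y) \<and>
     (\<forall>\<alpha>\<in>Field \<kappa>. \<sigma> \<alpha> \<in> Hom E (x \<alpha>) y \<and> FArr A (\<sigma> \<alpha>) = b) \<and>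
     (\<forall>\<beta> \<alpha>. (\<beta>, \<alpha>) \<in> \<kappa> \<longrightarrow> \<sigma> \<alpha> \<cdot> link \<beta> \<alpha> = \<sigma> \<beta>)"
  unfolding L.cocone_over_def by auto

lemma LT_cocone_iff:
  "LT.cocone_over b y \<sigma> \<longleftrightarrow> y \<in> Obj E \<and> b \<in> Hom G B (FObj A y) \<and>
     (\<forall>\<alpha>\<in>Field \<kappa>. \<sigma> \<alpha> \<in> Hom E (FObj T (x \<alpha>)) y \<and> FArr A (\<sigma> \<alpha>) = b) \<and>
     (\<forall>\<beta> \<alpha>. (\<beta>, \<alpha>) \<in> \<kappa> \<longrightarrow> \<sigma> \<alpha> \<cdot> FArr T (link \<beta> \<alpha>) = \<sigma> \<beta>)"
  unfolding LT.cocone_over_def by (auto simp: comp_func_def)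

text \<open>The structure map \<open>k : T z \<rightarrow> z\<close> is the map out of the surcolimit of the \<open>T (x \<beta>)\<close> with components
  \<open>T (x \<beta>) \<rightarrow> x \<alpha> \<rightarrow> z\<close>, for any \<open>\<alpha>\<close> above \<open>\<beta>\<close>. The unit law is checked on the \<open>x \<beta>\<close>, the homomorphism
  property on the \<open>T (x \<beta>)\<close> and associativity on the \<open>T (T (x \<beta>))\<close>, which is why the surcolimit has to be
  preserved twice.\<close>

lemma colimit_algebra:
  assumes colim: "is_surcolimit E G A K chain B z \<iota>"
    and colim_T: "is_surcolimit E G A K (T \<circ>\<^sub>F chain) B (FObj T z) (\<lambda>\<alpha>. FArr T (\<iota> \<alpha>))"
    and colim_TT: "is_surcolimit E G A K (T \<circ>\<^sub>F T \<circ>\<^sub>F chain) B (FObj T (FObj T z))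
      (\<lambda>\<alpha>. FArr T (FArr T (\<iota> \<alpha>)))"
  shows "\<exists>y \<tau>. is_surcolimit EMCat G (EM_arity A) J D B y \<tau>"
proof -
  have Az [simp]: "FObj A z = B" and cocone: "L.cocone_over (Ide G B) z \<iota>"
    using colim by (simp_all add: L.surcolimit_iff)
  have z [simp]: "z \<in> Obj E"
    using cocone by (simp add: L_cocone_iff)
  have \<iota> [simp]: "\<iota> \<alpha> \<in> Arr E" "Dom E (\<iota> \<alpha>) = x \<alpha>" "Cod E (\<iota> \<alpha>) = z" "FArr A (\<iota> \<alpha>) = Ide G B"
    if "\<alpha> \<in> Field \<kappa>" for \<alpha>
    using cocone that by (simp_all add: L_cocone_iff)
  have \<iota>_link: "\<iota> \<alpha> \<cdot> link \<beta> \<alpha> = \<iota> \<beta>" if "(\<beta>, \<alpha>) \<in> \<kappa>" for \<beta> \<alpha>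
    using cocone that by (simp add: L_cocone_iff)
  have less_Field: "\<beta> \<in> Field \<kappa>" "\<alpha> \<in> Field \<kappa>" if "(\<beta>, \<alpha>) \<in> \<kappa> - Id" for \<beta> \<alpha>
    using that by (auto simp: FieldI1 FieldI2)
  have \<iota>_a_mono: "\<iota> \<beta> \<cdot> a \<gamma> \<beta> = \<iota> \<alpha> \<cdot> a \<gamma> \<alpha>" if "(\<gamma>, \<beta>) \<in> \<kappa> - Id" "(\<beta>, \<alpha>) \<in> \<kappa>" for \<alpha> \<beta> \<gamma>
  proof -
    have \<beta>\<alpha>: "\<beta> = \<alpha> \<or> (\<beta>, \<alpha>) \<in> \<kappa> - Id" and "\<alpha> \<in> Field \<kappa>"
      using that by (auto simp: FieldI2)
    have "\<iota> \<beta> \<cdot> a \<gamma> \<beta> = (\<iota> \<alpha> \<cdot> link \<beta> \<alpha>) \<cdot> a \<gamma> \<beta>"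
      by (simp only: \<iota>_link[OF that(2)])
    also have "\<dots> = \<iota> \<alpha> \<cdot> (link \<beta> \<alpha> \<cdot> a \<gamma> \<beta>)"
      using that(1) \<beta>\<alpha> \<open>\<alpha> \<in> Field \<kappa>\<close> by simp
    also have "\<dots> = \<iota> \<alpha> \<cdot> a \<gamma> \<alpha>"
      by (simp only: link_a[OF that(1) \<beta>\<alpha>])
    finally show ?thesis .
  qed
  \<comment> \<open>The composite \<open>T (x \<gamma>) \<rightarrow> x \<alpha> \<rightarrow> z\<close> is independent of \<open>\<alpha>\<close>, since \<open>\<kappa>\<close> is totally ordered.\<close>
  have \<iota>_a: "\<iota> \<beta> \<cdot> a \<gamma> \<beta> = \<iota> \<alpha> \<cdot> a \<gamma> \<alpha>" if "(\<gamma>, \<beta>) \<in> \<kappa> - Id" "(\<gamma>, \<alpha>) \<in> \<kappa> - Id" for \<alpha> \<beta> \<gamma>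
    using order(4)[OF less_Field(2)[OF that(1)] less_Field(2)[OF that(2)]]
      \<iota>_a_mono[OF that(1)] \<iota>_a_mono[OF that(2)] by fastforce
  obtain nxt where nxt: "(\<beta>, nxt \<beta>) \<in> \<kappa> - Id" if "\<beta> \<in> Field \<kappa>" for \<beta>
    using order(6) by metis
  note nxt_Field [simp] = less_Field(2)[OF nxt]
  have "LT.cocone_over (Ide G B) z (\<lambda>\<beta>. \<iota> (nxt \<beta>) \<cdot> a \<beta> (nxt \<beta>))"
    unfolding LT_cocone_iff
  proof (intro conjI ballI allI impI)
    fix \<beta> assume \<beta>: "\<beta> \<in> Field \<kappa>"
    then show "\<iota> (nxt \<beta>) \<cdot> a \<beta> (nxt \<beta>) \<in> Hom E (FObj T (x \<beta>)) z"
      "FArr A (\<iota> (nxt \<beta>) \<cdot> a \<beta> (nxt \<beta>)) = Ide G B"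
      using nxt[OF \<beta>] by simp_all
  next
    fix \<gamma> \<beta> assume \<gamma>\<beta>: "(\<gamma>, \<beta>) \<in> \<kappa>"
    then have F: "\<gamma> \<in> Field \<kappa>" "\<beta> \<in> Field \<kappa>" and \<gamma>\<beta>': "\<gamma> = \<beta> \<or> (\<gamma>, \<beta>) \<in> \<kappa> - Id"
      by (auto simp: FieldI1 FieldI2)
    have \<gamma>n: "(\<gamma>, nxt \<beta>) \<in> \<kappa> - Id"
      using \<gamma>\<beta>' nxt[OF F(2)] less_less[of \<gamma> \<beta> "nxt \<beta>"] by metis
    have "(\<iota> (nxt \<beta>) \<cdot> a \<beta> (nxt \<beta>)) \<cdot> FArr T (link \<gamma> \<beta>) =
        \<iota> (nxt \<beta>) \<cdot> (a \<beta> (nxt \<beta>) \<cdot> FArr T (link \<gamma> \<beta>))"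
      using F \<gamma>\<beta>' nxt[OF F(2)] by simp
    also have "\<dots> = \<iota> (nxt \<beta>) \<cdot> a \<gamma> (nxt \<beta>)"
      by (simp only: a_T_link[OF \<gamma>\<beta>' nxt[OF F(2)]])
    also have "\<dots> = \<iota> (nxt \<gamma>) \<cdot> a \<gamma> (nxt \<gamma>)"
      by (rule \<iota>_a[OF \<gamma>n nxt[OF F(1)]])
    finally show "(\<iota> (nxt \<beta>) \<cdot> a \<beta> (nxt \<beta>)) \<cdot> FArr T (link \<gamma> \<beta>) = \<iota> (nxt \<gamma>) \<cdot> a \<gamma> (nxt \<gamma>)" .
  qed simp_all
  from LT.surcolimit_factor[OF colim_T this]
  obtain k where k [simp]: "k \<in> Arr E" "Dom E k = FObj T z" "Cod E k = z" "FArr A k = Ide G B"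
    and k_nxt: "\<And>\<beta>. \<beta> \<in> Field \<kappa> \<Longrightarrow> k \<cdot> FArr T (\<iota> \<beta>) = \<iota> (nxt \<beta>) \<cdot> a \<beta> (nxt \<beta>)"
    by auto
  have k_\<iota>: "k \<cdot> FArr T (\<iota> \<beta>) = \<iota> \<alpha> \<cdot> a \<beta> \<alpha>" if "(\<beta>, \<alpha>) \<in> \<kappa> - Id" for \<beta> \<alpha>
    using k_nxt[OF less_Field(1)[OF that]] \<iota>_a[OF nxt[OF less_Field(1)[OF that]] that] by simp
  have "k \<cdot> \<eta> z = Ide E z"
  proof (rule L.surcolimit_joint_epi[OF colim])
    fix \<beta> assume "\<beta> \<in> Obj K"
    then have \<beta> [simp]: "\<beta> \<in> Field \<kappa>" by simp
    have n: "\<beta> = nxt \<beta> \<or> (\<beta>, nxt \<beta>) \<in> \<kappa> - Id" "\<beta> \<noteq> nxt \<beta>" "(\<beta>, nxt \<beta>) \<in> \<kappa>"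
      using nxt[OF \<beta>] by auto
    have "(k \<cdot> \<eta> z) \<cdot> \<iota> \<beta> = (k \<cdot> FArr T (\<iota> \<beta>)) \<cdot> \<eta> (x \<beta>)"
      by (simp add: unit_natural[of "\<iota> \<beta>" "x \<beta>" z])
    also have "\<dots> = \<iota> (nxt \<beta>) \<cdot> (a \<beta> (nxt \<beta>) \<cdot> \<eta> (x \<beta>))"
      using nxt[OF \<beta>] by (simp add: k_nxt)
    also have "\<dots> = \<iota> \<beta>"
      using \<iota>_link[OF n(3)] n(2) by (simp add: link_def)
    finally show "(k \<cdot> \<eta> z) \<cdot> \<iota> \<beta> = Ide E z \<cdot> \<iota> \<beta>" by simp
  qed simp_all
  moreover have "k \<cdot> \<mu> z = k \<cdot> FArr T k"
  proof (rule LTT.surcolimit_joint_epi[OF colim_TT])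
    fix \<beta> assume "\<beta> \<in> Obj K"
    then have \<beta> [simp]: "\<beta> \<in> Field \<kappa>" by simp
    let ?\<gamma> = "nxt \<beta>"
    let ?\<delta> = "nxt ?\<gamma>"
    have \<beta>\<gamma>: "(\<beta>, ?\<gamma>) \<in> \<kappa> - Id" and \<gamma>\<delta>: "(?\<gamma>, ?\<delta>) \<in> \<kappa> - Id"
      by (simp_all only: nxt[OF \<beta>] nxt[OF nxt_Field[OF \<beta>]])
    then have \<beta>\<delta>: "(\<beta>, ?\<delta>) \<in> \<kappa> - Id" by (rule less_less)
    have "(k \<cdot> FArr T k) \<cdot> FArr T (FArr T (\<iota> \<beta>)) = k \<cdot> FArr T (k \<cdot> FArr T (\<iota> \<beta>))"
      by (simp add: T_Cmp)
    also have "\<dots> = k \<cdot> FArr T (\<iota> ?\<gamma> \<cdot> a \<beta> ?\<gamma>)"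
      by (simp only: k_\<iota>[OF \<beta>\<gamma>])
    also have "\<dots> = (k \<cdot> FArr T (\<iota> ?\<gamma>)) \<cdot> FArr T (a \<beta> ?\<gamma>)"
      using \<beta>\<gamma> by (simp add: T_Cmp)
    also have "\<dots> = (\<iota> ?\<delta> \<cdot> a ?\<gamma> ?\<delta>) \<cdot> FArr T (a \<beta> ?\<gamma>)"
      by (simp only: k_\<iota>[OF \<gamma>\<delta>])
    also have "\<dots> = \<iota> ?\<delta> \<cdot> (a ?\<gamma> ?\<delta> \<cdot> FArr T (a \<beta> ?\<gamma>))"
      using \<beta>\<gamma> \<gamma>\<delta> by simp
    also have "\<dots> = (\<iota> ?\<delta> \<cdot> a \<beta> ?\<delta>) \<cdot> \<mu> (x \<beta>)"
      using \<beta>\<delta> by (simp add: a_assoc[OF \<beta>\<gamma> \<gamma>\<delta>])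
    also have "\<dots> = k \<cdot> (FArr T (\<iota> \<beta>) \<cdot> \<mu> (x \<beta>))"
      by (simp add: k_\<iota>[OF \<beta>\<delta>, symmetric])
    also have "\<dots> = (k \<cdot> \<mu> z) \<cdot> FArr T (FArr T (\<iota> \<beta>))"
      by (simp add: mult_natural[of "\<iota> \<beta>" "x \<beta>" z])
    finally show "(k \<cdot> \<mu> z) \<cdot> FArr T (FArr T (\<iota> \<beta>)) = (k \<cdot> FArr T k) \<cdot> FArr T (FArr T (\<iota> \<beta>))"
      by (rule sym)
  qed simp_all
  ultimately have alg: "is_algebra E T \<eta> \<mu> (z, k)"
    by (simp add: is_algebra_def)
  obtain \<alpha>\<^sub>0 where \<alpha>\<^sub>0 [simp]: "\<alpha>\<^sub>0 \<in> Field \<kappa>"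
    using \<kappa> unfolding cinfinite_def by (metis finite.emptyI equals0I)
  \<comment> \<open>The colimiting cocone factors through any stage; \<open>\<alpha>\<^sub>0\<close> is an arbitrary one.\<close>
  define i where "i j = \<iota> \<alpha>\<^sub>0 \<cdot> c \<alpha>\<^sub>0 j" for j
  have \<iota>_c_mono: "\<iota> \<alpha> \<cdot> c \<alpha> j = \<iota> \<beta> \<cdot> c \<beta> j" if "(\<beta>, \<alpha>) \<in> \<kappa>" and j: "j \<in> Obj J" for \<alpha> \<beta> j
  proof -
    have \<beta>\<alpha>: "\<beta> = \<alpha> \<or> (\<beta>, \<alpha>) \<in> \<kappa> - Id" and "\<alpha> \<in> Field \<kappa>"
      using that by (auto simp: FieldI2)
    have "\<iota> \<alpha> \<cdot> c \<alpha> j = \<iota> \<alpha> \<cdot> (link \<beta> \<alpha> \<cdot> c \<beta> j)"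
      by (simp only: link_c[OF \<beta>\<alpha> j])
    also have "\<dots> = (\<iota> \<alpha> \<cdot> link \<beta> \<alpha>) \<cdot> c \<beta> j"
      using \<beta>\<alpha> j \<open>\<alpha> \<in> Field \<kappa>\<close> by simp
    also have "\<dots> = \<iota> \<beta> \<cdot> c \<beta> j"
      by (simp only: \<iota>_link[OF that(1)])
    finally show ?thesis .
  qed
  have \<iota>_c: "\<iota> \<alpha> \<cdot> c \<alpha> j = i j" if "\<alpha> \<in> Field \<kappa>" "j \<in> Obj J" for \<alpha> j
    using order(4)[OF that(1) \<alpha>\<^sub>0] \<iota>_c_mono that(2) unfolding i_def by metis
  have i_typing [simp]: "i j \<in> Arr E" "Dom E (i j) = X j" "Cod E (i j) = z" "FArr A (i j) = Ide G B"
    if "j \<in> Obj J" for j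
    using that by (simp_all add: i_def)
  have i_hom: "i j \<cdot> h j = k \<cdot> FArr T (i j)" if j: "j \<in> Obj J" for j
  proof -
    note n = nxt[OF \<alpha>\<^sub>0]
    have "i j \<cdot> h j = \<iota> (nxt \<alpha>\<^sub>0) \<cdot> (c (nxt \<alpha>\<^sub>0) j \<cdot> h j)"
      using j by (simp add: \<iota>_c[OF nxt_Field[OF \<alpha>\<^sub>0] j, symmetric])
    also have "\<dots> = (\<iota> (nxt \<alpha>\<^sub>0) \<cdot> a \<alpha>\<^sub>0 (nxt \<alpha>\<^sub>0)) \<cdot> FArr T (c \<alpha>\<^sub>0 j)"
      using j n by (simp add: a_c[OF n j, symmetric])
    also have "\<dots> = k \<cdot> FArr T (i j)"
      using j by (simp add: k_nxt[OF \<alpha>\<^sub>0, symmetric] i_def T_Cmp)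
    finally show ?thesis .
  qed
  have i_cocone: "i (Cod J f) \<cdot> d f = i (Dom J f)" if "f \<in> Arr J" for f
    using that by (simp add: i_def c_cocone)
  have "is_surcolimit EMCat G (EM_arity A) J D B (z, k) (\<lambda>j. (FObj D j, i j, (z, k)))"
    unfolding EM.surcolimit_iff
  proof (intro conjI allI impI)
    show "EM.cocone_over (Ide G B) (z, k) (\<lambda>j. (FObj D j, i j, (z, k)))"
      using alg i_hom i_cocone by (simp add: EM_cocone_iff U.cocone_over_def)
  next
    fix b y \<sigma>
    assume \<sigma>: "EM.cocone_over b y \<sigma>"
    let ?s = "\<lambda>j. fst (snd (\<sigma> j))"
    have y: "is_algebra E T \<eta> \<mu> y" and s: "U.cocone_over b (fst y) ?s"
      and hom: "\<And>j. j \<in> Obj J \<Longrightarrow> ?s j \<cdot> h j = snd y \<cdot> FArr T (?s j)"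
      and \<sigma>_eq: "\<And>j. j \<in> Obj J \<Longrightarrow> fst (\<sigma> j) = FObj D j \<and> snd (snd (\<sigma> j)) = y"
      using \<sigma> unfolding EM_cocone_iff by blast+
    note [simp] = algebraD(1-4)[OF y] algebra_arity[OF y]
    have b [simp]: "b \<in> Arr G" "Dom G b = B" "Cod G b = FObj A (fst y)"
      using s by (simp_all add: U.cocone_over_def)
    obtain g where g: "\<And>\<alpha>. is_extension b y ?s g \<alpha> (g \<alpha>)"
      using extension_exists[OF y s hom] by blast
    then have g_typing [simp]: "g \<alpha> \<in> Arr E" "Dom E (g \<alpha>) = x \<alpha>" "Cod E (g \<alpha>) = fst y"
        "FArr A (g \<alpha>) = b"
      and g_c: "\<And>j. j \<in> Obj J \<Longrightarrow> g \<alpha> \<cdot> c \<alpha> j = ?s j"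
      and g_a: "\<And>\<beta>. (\<beta>, \<alpha>) \<in> \<kappa> - Id \<Longrightarrow> g \<alpha> \<cdot> a \<beta> \<alpha> = snd y \<cdot> FArr T (g \<beta>)" for \<alpha>
      unfolding is_extension_def by simp_all
    have "g \<alpha> \<cdot> link \<beta> \<alpha> = g \<beta>" if "(\<beta>, \<alpha>) \<in> \<kappa>" for \<beta> \<alpha>
      using extension_link[OF y g, of \<beta> \<alpha>] that by blast
    then have "L.cocone_over b (fst y) g"
      by (simp add: L_cocone_iff)
    from L.surcolimit_factor[OF colim this]
    obtain f where f [simp]: "f \<in> Arr E" "Dom E f = z" "Cod E f = fst y" "FArr A f = b"
      and f_\<iota>: "\<And>\<alpha>. \<alpha> \<in> Field \<kappa> \<Longrightarrow> f \<cdot> \<iota> \<alpha> = g \<alpha>"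
      by auto
    have "f \<cdot> k = snd y \<cdot> FArr T f"
    proof (rule LT.surcolimit_joint_epi[OF colim_T])
      fix \<beta> assume "\<beta> \<in> Obj K"
      then have \<beta> [simp]: "\<beta> \<in> Field \<kappa>" by simp
      note n = nxt[OF \<beta>]
      have "(f \<cdot> k) \<cdot> FArr T (\<iota> \<beta>) = f \<cdot> (k \<cdot> FArr T (\<iota> \<beta>))"
        by simp
      also have "\<dots> = (f \<cdot> \<iota> (nxt \<beta>)) \<cdot> a \<beta> (nxt \<beta>)"
        using n by (simp add: k_nxt)
      also have "\<dots> = snd y \<cdot> FArr T (f \<cdot> \<iota> \<beta>)"
        by (simp only: f_\<iota>[OF \<beta>] f_\<iota>[OF nxt_Field[OF \<beta>]] g_a[OF n])
      also have "\<dots> = (snd y \<cdot> FArr T f) \<cdot> FArr T (\<iota> \<beta>)"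
        by (simp add: T_Cmp)
      finally show "(f \<cdot> k) \<cdot> FArr T (\<iota> \<beta>) = (snd y \<cdot> FArr T f) \<cdot> FArr T (\<iota> \<beta>)" .
    qed simp_all
    then have "((z, k), f, y) \<in> Hom EMCat (z, k) y"
      using alg y by simp
    moreover have "((z, k), f, y) \<cdot>\<^bsub>EMCat\<^esub> (FObj D j, i j, (z, k)) = \<sigma> j" if j: "j \<in> Obj J" for j
    proof -
      have "f \<cdot> i j = (f \<cdot> \<iota> \<alpha>\<^sub>0) \<cdot> c \<alpha>\<^sub>0 j"
        using j by (simp add: i_def)
      also have "\<dots> = ?s j"
        by (simp only: f_\<iota>[OF \<alpha>\<^sub>0] g_c[OF j])
      finally show ?thesis
        using \<sigma>_eq[OF j] by (simp add: prod_eq_iff)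
    qed
    moreover have "FArr (EM_arity A) ((z, k), f, y) = b"
      by simp
    moreover have "t = ((z, k), f, y)"
      if t: "t \<in> Hom EMCat (z, k) y" "FArr (EM_arity A) t = b"
        "\<forall>j\<in>Obj J. t \<cdot>\<^bsub>EMCat\<^esub> (FObj D j, i j, (z, k)) = \<sigma> j" for t
    proof -
      define f' where "f' = fst (snd t)"
      have t_eq: "t = ((z, k), f', y)"
        unfolding f'_def by (rule EM_Hom_eq[OF t(1)])
      have f' [simp]: "f' \<in> Arr E" "Dom E f' = z" "Cod E f' = fst y" "FArr A f' = b"
        and f'_k: "f' \<cdot> k = snd y \<cdot> FArr T f'"
        using t(1,2) by (simp_all add: t_eq)
      have f'_i: "f' \<cdot> i j = ?s j" if "j \<in> Obj J" for j
      proof -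
        have "\<sigma> j = t \<cdot>\<^bsub>EMCat\<^esub> (FObj D j, i j, (z, k))" using t(3) that by simp
        then show ?thesis by (simp add: t_eq)
      qed
      \<comment> \<open>Restricted to the chain, a homomorphism is an extension, hence equal to \<open>g\<close>. Indices outside
        the field of \<open>\<kappa>\<close> have no predecessors and no leg into \<open>z\<close>; there \<open>g\<close> itself serves.\<close>
      define g' where "g' \<alpha> = (if \<alpha> \<in> Field \<kappa> then f' \<cdot> \<iota> \<alpha> else g \<alpha>)" for \<alpha>
      have g': "is_extension b y ?s g' \<alpha> (g' \<alpha>)" for \<alpha>
      proof (cases "\<alpha> \<in> Field \<kappa>")
        case \<alpha> [simp]: True
        have "(f' \<cdot> \<iota> \<alpha>) \<cdot> c \<alpha> j = ?s j" if "j \<in> Obj J" for j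
          using that \<iota>_c[OF \<alpha> that] f'_i[OF that] by simp
        moreover have "(f' \<cdot> \<iota> \<alpha>) \<cdot> a \<beta> \<alpha> = snd y \<cdot> FArr T (f' \<cdot> \<iota> \<beta>)" if \<beta>\<alpha>: "(\<beta>, \<alpha>) \<in> \<kappa> - Id" for \<beta>
        proof -
          have \<beta> [simp]: "\<beta> \<in> Field \<kappa>" using less_Field[OF \<beta>\<alpha>] by blast
          have "(f' \<cdot> \<iota> \<alpha>) \<cdot> a \<beta> \<alpha> = f' \<cdot> (\<iota> \<alpha> \<cdot> a \<beta> \<alpha>)"
            using \<beta>\<alpha> by simp
          also have "\<dots> = (f' \<cdot> k) \<cdot> FArr T (\<iota> \<beta>)"
            by (simp add: k_\<iota>[OF \<beta>\<alpha>, symmetric])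
          also have "\<dots> = (snd y \<cdot> FArr T f') \<cdot> FArr T (\<iota> \<beta>)"
            by (simp only: f'_k)
          also have "\<dots> = snd y \<cdot> FArr T (f' \<cdot> \<iota> \<beta>)"
            by (simp add: T_Cmp)
          finally show ?thesis .
        qed
        moreover have "\<beta> \<in> Field \<kappa>" if "(\<beta>, \<alpha>) \<in> \<kappa> - Id" for \<beta>
          using less_Field[OF that] by blast
        ultimately show ?thesis
          unfolding is_extension_def g'_def by simp
      next
        case False
        then have "(\<beta>, \<alpha>) \<notin> \<kappa>" for \<beta>
          by (auto dest: FieldI2)
        then show ?thesis
          using False g[of \<alpha>] unfolding is_extension_def g'_def by simp
      qed
      have "g' \<alpha> = g \<alpha>" for \<alpha>
        by (rule extension_unique[OF y s hom g' g])
      moreover have "g' \<alpha> = f' \<cdot> \<iota> \<alpha>" if "\<alpha> \<in> Field \<kappa>" for \<alpha>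
        using that by (simp add: g'_def)
      ultimately have "f' \<cdot> \<iota> \<alpha> = g \<alpha>" if "\<alpha> \<in> Field \<kappa>" for \<alpha>
        using that by simp
      then have "f' = f"
        by (intro L.surcolimit_joint_epi[OF colim, of f' "fst y" f]) (simp_all add: f_\<iota>)
      then show ?thesis by (simp add: t_eq)
    qed
    ultimately show "\<exists>!t. t \<in> Hom EMCat (z, k) y \<and> FArr (EM_arity A) t = b \<and>
        (\<forall>j\<in>Obj J. t \<cdot>\<^bsub>EMCat\<^esub> (FObj D j, i j, (z, k)) = \<sigma> j)"
      by blast
  qed simp
  then show ?thesis by blast
qed

end

text \<open>The chain is chosen by well-founded recursion. Each choice depends on the stages below only;
  these are indexed by elements of the small cardinal \<open>\<kappa>\<close>, so the presentation of the next stage is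
  small.\<close>

lemma (in algebra_diagram) surcolimit_exists:
  fixes \<kappa> :: "'u rel"
  assumes cocomplete: "surcocomplete TYPE('u) E G A" and small: "|Arr J| <o |UNIV :: 'u set|"
    and \<kappa>: "small_regular_cardinal \<kappa>" and preserves: "preserves_filtered_surcolimits \<kappa> E G A T"
  shows "\<exists>y \<tau>. is_surcolimit EMCat G (EM_arity A) J D B y \<tau>"
proof -
  have card: "Cinfinite \<kappa>" "regularCard \<kappa>" "\<kappa> <o |UNIV :: 'u set|"
    using \<kappa> by (simp_all add: small_regular_cardinal_def)
  note order = Card_order_props[OF card(1)]
  have inf: "infinite (UNIV :: 'u set)"
    using card(1) unfolding cinfinite_def by (metis finite_subset subset_UNIV)
  have Field_small: "|Field \<kappa>| <o |UNIV :: 'u set|"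
    using card card_of_Field_ordIso ordIso_ordLess_trans by blast
  have trans: "trans (\<kappa> - Id)"
    using order(2,3) by (rule trans_diff_Id)
  have below_small: "|{\<beta>. (\<beta>, \<alpha>) \<in> \<kappa> - Id}| <o |UNIV :: 'u set|" for \<alpha>
  proof -
    have "{\<beta>. (\<beta>, \<alpha>) \<in> \<kappa> - Id} \<subseteq> Field \<kappa>"
      by (auto simp: FieldI1)
    then show ?thesis
      using card_of_mono1 Field_small by (blast intro: ordLeq_ordLess_trans)
  qed
  have "\<exists>S. \<forall>\<alpha>. is_stage (\<kappa> - Id) S \<alpha> (S \<alpha>)"
  proof (rule dependent_wf_choice[OF order(5)])
    show "is_stage (\<kappa> - Id) S \<alpha> s = is_stage (\<kappa> - Id) S' \<alpha> s"
      if "\<And>\<beta>. (\<beta>, \<alpha>) \<in> \<kappa> - Id \<Longrightarrow> S \<beta> = S' \<beta>" for S S' \<alpha> s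
      using is_stage_cong[OF trans that] by simp
    show "\<exists>s. is_stage (\<kappa> - Id) S \<alpha> s"
      if "\<And>\<beta>. (\<beta>, \<alpha>) \<in> \<kappa> - Id \<Longrightarrow> is_stage (\<kappa> - Id) S \<beta> (S \<beta>)" for S \<alpha>
      by (rule stage_exists[OF cocomplete inf small below_small trans that])
  qed
  then obtain S where S: "\<And>\<alpha>. is_stage (\<kappa> - Id) S \<alpha> (S \<alpha>)"
    by blast
  have "|(UNIV :: 'u set) \<times> (UNIV :: 'u set)| \<le>o |UNIV :: 'u set|"
    using card_of_Times_same_infinite[OF inf] by (rule ordIso_imp_ordLeq)
  then obtain e :: "'u \<times> 'u \<Rightarrow> 'u" where e: "inj e"
    unfolding card_of_ordLeq[symmetric] UNIV_Times_UNIV by blast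
  interpret cardinal_action_chain E G A T \<eta> \<mu> J D B \<kappa> S e
    using order(5) trans S card(1) e by unfold_locales
  have "|e ` \<kappa>| \<le>o |Field \<kappa> \<times> Field \<kappa>|"
  proof (rule ordLeq_transitive[OF card_of_image card_of_mono1])
    show "\<kappa> \<subseteq> Field \<kappa> \<times> Field \<kappa>"
      by (auto simp: FieldI1 FieldI2)
  qed
  then have "|Arr K| <o |UNIV :: 'u set|"
    using card_of_Times_ordLess_infinite[OF inf Field_small Field_small]
    by (simp add: ordLeq_ordLess_trans)
  then have K: "small_category K" "filtered_category \<kappa> K"
    using category_K filtered_order_cat[OF card(1,2) e] by (simp_all add: small_category_def)
  note preserved = preserves[unfolded preserves_filtered_surcolimits_def, rule_format, of K, OF conjI,
      OF K(1) conjI, OF K(2) conjI]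
  obtain z \<iota> where colim: "is_surcolimit E G A K chain B z \<iota>"
    using cocomplete K(1) surdiagram_chain unfolding surcocomplete_def by blast
  note colim_T = preserved[OF surdiagram_chain colim]
  show ?thesis
    using colimit_algebra[OF colim colim_T preserved[OF LT.surdiagram colim_T]] .
qed

theorem theorem3:
  fixes C :: "('o, 'm) cat" and G :: "('p, 'n) cat" and A :: "('o, 'm, 'p, 'n) func"
    and T :: "('o, 'm, 'o, 'm) func" and \<eta> \<mu> :: "'o \<Rightarrow> 'm" and \<kappa> :: "'u rel"
  assumes "surcategory C G A"
    and "surcomplete TYPE('u) C G A"
    and "surcocomplete TYPE('u) C G A"
    and "has_K_equalizers C G A"
    and "surmonad C G A T \<eta> \<mu>"
    and "small_regular_cardinal \<kappa>"
    and "preserves_filtered_surcolimits \<kappa> C G A T"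
  shows "surcomplete TYPE('u) (EM C T \<eta> \<mu>) G (EM_arity A)
    \<and> surcocomplete TYPE('u) (EM C T \<eta> \<mu>) G (EM_arity A)
    \<and> has_K_equalizers (EM C T \<eta> \<mu>) G (EM_arity A)"
proof (intro conjI)
  interpret surmonad C G A T \<eta> \<mu> by fact
  have diagram: "algebra_diagram C G A T \<eta> \<mu> J D B"
    if "small_category J \<and> surdiagram (EM C T \<eta> \<mu>) G (EM_arity A) J D B" for J :: "('u, 'u) cat" and D B
    using that surmonad_axioms
    by (simp add: algebra_diagram_def algebra_diagram_axioms_def small_category_def)
  show "surcomplete TYPE('u) (EM C T \<eta> \<mu>) G (EM_arity A)"
    unfolding surcomplete_def
  proof (intro allI impI)
    fix J :: "('u, 'u) cat" and D B
    assume D: "small_category J \<and> surdiagram (EM C T \<eta> \<mu>) G (EM_arity A) J D B"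
    interpret algebra_diagram C G A T \<eta> \<mu> J D B
      using D by (rule diagram)
    show "\<exists>x \<tau>. is_surlimit (EM C T \<eta> \<mu>) G (EM_arity A) J D B x \<tau>"
      using assms(2) D U.surdiagram surlimit_creation unfolding surcomplete_def by blast
  qed
  show "surcocomplete TYPE('u) (EM C T \<eta> \<mu>) G (EM_arity A)"
    unfolding surcocomplete_def
  proof (intro allI impI)
    fix J :: "('u, 'u) cat" and D B
    assume D: "small_category J \<and> surdiagram (EM C T \<eta> \<mu>) G (EM_arity A) J D B"
    interpret algebra_diagram C G A T \<eta> \<mu> J D B
      using D by (rule diagram)
    show "\<exists>x \<tau>. is_surcolimit (EM C T \<eta> \<mu>) G (EM_arity A) J D B x \<tau>"
      using D by (intro surcolimit_exists[OF assms(3) _ assms(6,7)]) (simp add: small_category_def)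
  qed
  show "has_K_equalizers (EM C T \<eta> \<mu>) G (EM_arity A)"
    using assms(4) by (rule K_equalizer_creation)
qed

end
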